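(* Let $k\in\mathbb Z$, $N\in\mathbb N$, and let $f\in S_k^!(N)$. Then for each $m\in\mathbb Z$ we have $$L^*(f,m)=i^{-m}\int_{i}^{i+1} f(z)\,\zeta^*(1-m,z)\,dz .$$
   Context: $S_k^!(N)$ is the space of weakly holomorphic cusp forms of weight $k$ for $\Gamma_0(N)$, i.e. weakly holomorphic modular forms of weight $k$ for $\Gamma_0(N)$ (holomorphic on the upper half-plane, meromorphic at the cusps) with vanishing constant terms at all cusps. Such $f$ has a Fourier expansion $f(z)=\sum_{n\ge -n_0,\ n\neq 0}a_f(n)e^{2\pi i n z}$ for some $n_0\in\mathbb N$. $L^*(f,s):=\sum_{n\ge -n_0,\ n\neq 0}a_f(n)E_{1-s}(2\pi n)$. Here $E_s(z)=\int_1^\infty e^{-zt}t^{-s}dt$ for $\operatorname{Re}(z)>0$, continued analytically in $z$ to $\mathbb C\setminus(-\infty,0]$, and extended to negative real $z$ by using the principal branch of the logarithm, i.e. $E_s(x)=\lim_{\epsilon\to0^+}E_s(x+i\epsilon)$ for $x<0$. $\zeta^*(a,z)$ denotes the constant term in the Laurent expansion at $s=a$ of the Hurwitz zeta function $\zeta(s,z)$ (the meromorphic continuation in $s$ of $\sum_{n\ge0}(z+n)^{-s}$); that is, $\zeta^*(a,z)=\zeta(a,z)$ if $a\ne1$ and $\zeta^*(1,z)=-\psi(z)$, where $\psi=\Gamma'/\Gamma$ is the digamma function. The integral is along the horizontal segment from $i$ to $i+1$. *)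

theory Defs
  imports "HOL-Complex_Analysis.Complex_Analysis"
begin

definition SL2Z :: "(int ^ 2 ^ 2) set" where
  "SL2Z = {\<gamma>. det \<gamma> = 1}"

definition Gamma0 :: "nat \<Rightarrow> (int ^ 2 ^ 2) set" where
  "Gamma0 N = {\<gamma> \<in> SL2Z. int N dvd \<gamma> $ 2 $ 1}"

definition slash :: "int \<Rightarrow> int ^ 2 ^ 2 \<Rightarrow> (complex \<Rightarrow> complex) \<Rightarrow> complex \<Rightarrow> complex" where
  "slash k \<gamma> f z =
     (of_int (\<gamma> $ 2 $ 1) * z + of_int (\<gamma> $ 2 $ 2)) powi (- k) *
     f ((of_int (\<gamma> $ 1 $ 1) * z + of_int (\<gamma> $ 1 $ 2)) /
        (of_int (\<gamma> $ 2 $ 1) * z + of_int (\<gamma> $ 2 $ 2)))"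

definition transl :: "nat \<Rightarrow> int ^ 2 ^ 2" where
  "transl h = vector [vector [1, int h], vector [0, 1]]"

text \<open>
  Every cusp is the image of \<open>\<infinity>\<close> under some \<open>\<gamma>\<close> in \<open>SL2Z\<close>. Because \<open>- mat 1\<close> lies in
  \<open>Gamma0 N\<close>, no sign has to be allowed for in the following definition of its width.
\<close>

definition cusp_width :: "nat \<Rightarrow> int ^ 2 ^ 2 \<Rightarrow> nat" where
  "cusp_width N \<gamma> = (LEAST h. h > 0 \<and> \<gamma> ** transl h ** matrix_inv \<gamma> \<in> Gamma0 N)"

definition has_fourier_expansion :: "(complex \<Rightarrow> complex) \<Rightarrow> nat \<Rightarrow> (int \<Rightarrow> complex) \<Rightarrow> bool" where
  "has_fourier_expansion f h a \<longleftrightarrow>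
     (\<exists>n0 :: nat. \<forall>n < - int n0. a n = 0) \<and>
     (\<forall>z. Im z > 0 \<longrightarrow>
        ((\<lambda>n. a n * exp (2 * of_real pi * \<i> * of_int n * z / of_nat h)) has_sum f z) UNIV)"

definition fourier_coeff :: "(complex \<Rightarrow> complex) \<Rightarrow> nat \<Rightarrow> int \<Rightarrow> complex" where
  "fourier_coeff f h = (THE a. has_fourier_expansion f h a)"

text \<open>
  Only the values of \<open>f\<close> on the upper half-plane matter here and below. Meromorphy at the cusp
  \<open>\<gamma> \<infinity>\<close> is the existence of an expansion of \<open>slash k \<gamma> f\<close> with finite principal part; since
  \<open>slash k \<gamma> f\<close> is holomorphic on the upper half-plane, that expansion converges on all of it.
\<close>

definition weakly_holomorphic_forms :: "int \<Rightarrow> nat \<Rightarrow> (complex \<Rightarrow> complex) set" where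
  "weakly_holomorphic_forms k N =
     {f. f holomorphic_on {z. Im z > 0} \<and>
         (\<forall>\<gamma> \<in> Gamma0 N. \<forall>z. Im z > 0 \<longrightarrow> slash k \<gamma> f z = f z) \<and>
         (\<forall>\<gamma> \<in> SL2Z. \<exists>a. has_fourier_expansion (slash k \<gamma> f) (cusp_width N \<gamma>) a)}"

definition weakly_holomorphic_cusp_forms :: "int \<Rightarrow> nat \<Rightarrow> (complex \<Rightarrow> complex) set" where
  "weakly_holomorphic_cusp_forms k N =
     {f \<in> weakly_holomorphic_forms k N.
        \<forall>\<gamma> \<in> SL2Z. fourier_coeff (slash k \<gamma> f) (cusp_width N \<gamma>) 0 = 0}"

text \<open>
  The generalised exponential integral. The conditions determine the function everywhere except
  at \<open>0\<close>, where it is left unspecified: on the slit plane by analytic continuation, on the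
  negative reals as the boundary value from above (principal branch of the logarithm).
\<close>

definition exp_integral_E :: "complex \<Rightarrow> complex \<Rightarrow> complex" where
  "exp_integral_E s = (SOME g.
     g holomorphic_on (- \<real>\<^sub>\<le>\<^sub>0) \<and>
     (\<forall>z. Re z > 0 \<longrightarrow> g z = integral {1..} (\<lambda>t. exp (- z * of_real t) * of_real t powr (- s))) \<and>
     (\<forall>x::real. x < 0 \<longrightarrow>
        ((\<lambda>\<epsilon>. g (of_real x + \<i> * of_real \<epsilon>)) \<longlongrightarrow> g (of_real x)) (at_right 0)))"

definition L_star :: "(complex \<Rightarrow> complex) \<Rightarrow> complex \<Rightarrow> complex" where
  "L_star f s = (\<Sum>\<^sub>\<infinity>n\<in>{n::int. n \<noteq> 0}.
     fourier_coeff f 1 n * exp_integral_E (1 - s) (2 * of_real pi * of_int n))"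

text \<open>
  The Hurwitz zeta function, as a function of \<open>s\<close> for fixed \<open>z\<close>. Requiring the continuation to
  be \<^emph>\<open>nicely\<close> meromorphic fixes its values at removable singularities and poles, so that it is
  unique.
\<close>

definition hurwitz_zeta :: "complex \<Rightarrow> complex \<Rightarrow> complex" where
  "hurwitz_zeta s z = (THE g.
     g nicely_meromorphic_on UNIV \<and>
     (\<forall>s. Re s > 1 \<longrightarrow> (\<lambda>n. (z + of_nat n) powr (- s)) sums g s)) s"

definition zeta_star :: "complex \<Rightarrow> complex \<Rightarrow> complex" where
  "zeta_star a z = fls_nth (laurent_expansion (\<lambda>s. hurwitz_zeta s z) a) 0"

end

theory Submission
  imports Defs
begin

text \<open>
  Put \<open>e\<^sub>n(z) = exp (2 \<pi> i n z)\<close> and \<open>x = 2 \<pi> n\<close>. The modulus of \<open>e\<^sub>n\<close> is constant on the segment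
  from \<open>\<i>\<close> to \<open>\<i> + 1\<close>, so the Fourier expansion of \<open>f\<close>, which converges absolutely at \<open>\<i>\<close>,
  converges uniformly there and may be integrated term by term against any continuous function
  (\<open>fourier_expansion_integral\<close>). The constant term of \<open>f\<close> vanishes, so the theorem reduces to the
  identity
  \<open>\<i> powr (s - 1) * (integral of e\<^sub>n(z) \<zeta>\<^sup>*(s, z) from \<i> to \<i> + 1) = E\<^sub>s(x)\<close>
  for integers \<open>s\<close> and \<open>n \<noteq> 0\<close> (\<open>zeta_fourier_eq_exp_integral\<close>).

  This identity is proved by showing that both sides obey the same recurrence in \<open>s\<close>. On the left
  one integrates by parts, using \<open>d/dz \<zeta>\<^sup>*(s, z) = - s \<zeta>\<^sup>*(s + 1, z)\<close> for \<open>s \<noteq> 0\<close> and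
  \<open>\<zeta>\<^sup>*(s, z + 1) = \<zeta>\<^sup>*(s, z) - z powr (- s)\<close>; since \<open>e\<^sub>n\<close> has period one, the boundary term is an
  elementary expression (\<open>zeta_fourier_rec\<close>). On the right it is the classical
  \<open>x E\<^sub>s(x) = exp (- x) - s E\<^sub>s\<^sub>+\<^sub>1(x)\<close> (\<open>exp_integral_E_rec\<close>). At \<open>s = 0\<close> the recurrence loses the value
  at \<open>s + 1 = 1\<close>, so one has to start at \<open>s = 1\<close> and go in both directions. For the start
  the case \<open>s = 2\<close> is computed directly: \<open>\<zeta>(2, z)\<close> is a sum over translates of \<open>z powr (- 2)\<close>, which
  unfolds the integral over the unit segment into one over the horizontal ray from \<open>\<i>\<close> to
  \<open>\<i> + \<infinity>\<close>. The integrand \<open>e\<^sub>n(z) / z\<^sup>2\<close> has a primitive expressed by \<open>E\<^sub>1(- i x z)\<close>, and \<open>E\<^sub>1\<close> decays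
  along the ray (\<open>zeta_fourier_2\<close>).

  The Hurwitz zeta function is defined as a meromorphic continuation, so this has to be constructed
  together with its dependence on \<open>z\<close>. The function \<open>R(s, z) = (s - 1) \<zeta>(s, z)\<close> is
  entire in \<open>s\<close>, and partial integration over \<open>x\<close> in \<open>\<zeta>(s, z + x)\<close> gives
  \<open>R(s, z) = z powr (1 - s) + (s - 1) * (integral of (1 - x) R(s + 1, z + x) over x from 0 to 1)\<close>,
  which extends \<open>R\<close> to the left one unit at a time. The value \<open>\<zeta>\<^sup>*(s, z)\<close> is then
  \<open>R(s, z) / (s - 1)\<close> for \<open>s \<noteq> 1\<close>, and the \<open>s\<close>-derivative of \<open>R\<close> at \<open>s = 1\<close>
  (\<open>zeta_star_eq\<close>).
\<close>

section \<open>Holomorphic parameter integrals\<close>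

text \<open>
  By Morera's theorem: swapping the two integrations reduces the integral of the parameter integral
  over a triangle to Cauchy's theorem for each fixed \<open>x\<close>.
\<close>

lemma holomorphic_on_integral_param:
  fixes F :: "complex \<Rightarrow> real \<Rightarrow> complex"
  assumes S: "open S"
    and cont: "continuous_on (S \<times> {0..1}) (\<lambda>(s, x). F s x)"
    and hol: "\<And>x. x \<in> {0..1} \<Longrightarrow> (\<lambda>s. F s x) holomorphic_on S"
  shows "(\<lambda>s. integral {0..1} (F s)) holomorphic_on S"
proof -
  let ?G = "\<lambda>s. integral {0..1} (F s)"
  have contG: "continuous_on S ?G"
    using integral_continuous_on_param[of S 0 1 F] cont by simp
  have contlp: "continuous_on ({0..1} \<times> {0..1}) (\<lambda>(x, t). F (linepath a b t) x * (b - a))"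
    if "closed_segment a b \<subseteq> S" for a b
  proof -
    have "continuous_on ({0..1} \<times> {0..1}) ((\<lambda>(s, x). F s x) \<circ> (\<lambda>(x, t). (linepath a b t, x)))"
      unfolding split_beta
      by (intro continuous_on_compose continuous_on_subset[OF cont[unfolded split_beta]]
          continuous_on_Pair)
         (use subsetD[OF that linepath_in_path] in
            \<open>auto intro!: continuous_intros simp: linepath_def\<close>)
    then show ?thesis
      unfolding split_beta o_def by (intro continuous_intros) auto
  qed
  have swap: "contour_integral (linepath a b) ?G =
      integral {0..1} (\<lambda>x. contour_integral (linepath a b) (\<lambda>s. F s x))"
    and integ: "(\<lambda>x. contour_integral (linepath a b) (\<lambda>s. F s x)) integrable_on {0..1}"
    if "closed_segment a b \<subseteq> S" for a b
  proof -
    note c = contlp[OF that]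
    have "contour_integral (linepath a b) ?G =
        integral {0..1} (\<lambda>t. integral {0..1} (\<lambda>x. F (linepath a b t) x * (b - a)))"
      unfolding contour_integral_integral
      by (intro integral_cong) auto
    also have "\<dots> = integral {0..1} (\<lambda>x. integral {0..1} (\<lambda>t. F (linepath a b t) x * (b - a)))"
      using integral_swap_continuous[of "0::real" "0::real" "1::real" "1::real"
        "\<lambda>x t. F (linepath a b t) x * (b - a)", symmetric] c
      by (simp add: cbox_Pair_eq del: integral_mult_left)
    also have "\<dots> = integral {0..1} (\<lambda>x. contour_integral (linepath a b) (\<lambda>s. F s x))"
      unfolding contour_integral_integral
      by (intro integral_cong) auto
    finally show "contour_integral (linepath a b) ?G =
      integral {0..1} (\<lambda>x. contour_integral (linepath a b) (\<lambda>s. F s x))" .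
    have "continuous_on {0..1} (\<lambda>x. integral (cbox 0 1) (\<lambda>t. F (linepath a b t) x * (b - a)))"
      by (rule integral_continuous_on_param) (use c in simp)
    then have "continuous_on {0..1} (\<lambda>x. contour_integral (linepath a b) (\<lambda>s. F s x))"
      by (rule continuous_on_eq)
         (auto simp: contour_integral_integral intro!: integral_cong)
    then show "(\<lambda>x. contour_integral (linepath a b) (\<lambda>s. F s x)) integrable_on {0..1}"
      by (rule integrable_continuous_real)
  qed
  have "?G analytic_on S"
  proof (rule Morera_triangle[OF contG S], safe)
    fix a b c assume sub: "convex hull {a, b, c} \<subseteq> S"
    have seg: "closed_segment a b \<subseteq> S" "closed_segment b c \<subseteq> S" "closed_segment c a \<subseteq> S"
      using sub hull_subset[of "{a,b,c}" convex] convex_convex_hull[of "{a,b,c}"]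
      by (meson closed_segment_subset dual_order.trans insert_iff subset_iff)+
    have "contour_integral (linepath a b) (\<lambda>s. F s x) + contour_integral (linepath b c) (\<lambda>s. F s x)
        + contour_integral (linepath c a) (\<lambda>s. F s x) = 0" if "x \<in> {0..1}" for x
    proof -
      have "((\<lambda>s. F s x) has_contour_integral 0) (linepath a b +++ linepath b c +++ linepath c a)"
        by (rule Cauchy_theorem_triangle[OF holomorphic_on_subset[OF hol[OF that] sub]])
      then have "contour_integral (linepath a b +++ linepath b c +++ linepath c a) (\<lambda>s. F s x) = 0"
        by (rule contour_integral_unique)
      moreover have "(\<lambda>s. F s x) contour_integrable_on linepath p q"
        if "closed_segment p q \<subseteq> S" for p q
        by (intro contour_integrable_continuous_linepath holomorphic_on_imp_continuous_on
            holomorphic_on_subset[OF hol[OF \<open>x \<in> _\<close>] that])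
      ultimately show ?thesis
        using seg by (simp add: add.assoc contour_integral_join contour_integrable_joinI valid_path_join)
    qed
    moreover have "contour_integral (linepath a b) ?G + contour_integral (linepath b c) ?G
        + contour_integral (linepath c a) ?G = 
        integral {0..1} (\<lambda>x. contour_integral (linepath a b) (\<lambda>s. F s x)
          + contour_integral (linepath b c) (\<lambda>s. F s x) + contour_integral (linepath c a) (\<lambda>s. F s x))"
      using integ[OF seg(1)] integ[OF seg(2)] integ[OF seg(3)]
      by (simp only: swap[OF seg(1)] swap[OF seg(2)] swap[OF seg(3)] integral_add integrable_add)
    moreover have "integral {0..1} (\<lambda>x. contour_integral (linepath a b) (\<lambda>s. F s x)
          + contour_integral (linepath b c) (\<lambda>s. F s x) + contour_integral (linepath c a) (\<lambda>s. F s x)) = 0"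
      by (rule integral_unique[OF has_integral_is_0]) (use calculation in blast)
    ultimately show "contour_integral (linepath a b) ?G + contour_integral (linepath b c) ?G
        + contour_integral (linepath c a) ?G = 0"
      by simp
  qed
  then show ?thesis
    by (rule analytic_imp_holomorphic)
qed

section \<open>The Hurwitz series\<close>

abbreviation uhp :: "complex set" where "uhp \<equiv> {z. Im z > 0}"

lemma open_uhp: "open uhp" and convex_uhp: "convex uhp"
  by (auto simp: open_halfspace_Im_gt convex_halfspace_Im_gt)

lemma nonpos_Reals_uhp: "Im z > 0 \<Longrightarrow> z \<notin> \<real>\<^sub>\<le>\<^sub>0"
  by (auto simp: complex_nonpos_Reals_iff)

text \<open>
  A majorant that is uniform in \<open>s\<close> and in \<open>z\<close>. For large \<open>n\<close> one has \<open>\<bar>z + n\<bar> \<ge> n / 2\<close> and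
  \<open>Re s \<ge> 1 + d\<close>, while the argument of \<open>z + n\<close> contributes at most the factor
  \<open>exp (\<pi> \<bar>Im s\<bar>)\<close>.
\<close>

lemma hurwitz_series_bound:
  fixes s0 z0 :: complex
  assumes "Re s0 > 1"
  obtains d :: real and h :: "nat \<Rightarrow> real" where "d > 0" "summable h" "\<And>n. h n \<ge> 0"
    "\<forall>\<^sub>F n in sequentially. \<forall>s\<in>ball s0 d. \<forall>z\<in>ball z0 d. norm ((z + of_nat n) powr (- s)) \<le> h n"
proof -
  define d where "d = (Re s0 - 1) / 2"
  define h where "h n = exp (pi * (norm s0 + d)) * 2 powr (1 + d) * real n powr (- (1 + d))" for n
  have d: "d > 0" using assms by (simp add: d_def)
  have "summable h"
    unfolding h_def by (intro summable_mult) (use d in \<open>simp add: summable_real_powr_iff\<close>)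
  moreover have "h n \<ge> 0" for n by (simp add: h_def)
  moreover have "\<forall>\<^sub>F n in sequentially. \<forall>s\<in>ball s0 d. \<forall>z\<in>ball z0 d.
      norm ((z + of_nat n) powr (- s)) \<le> h n"
  proof -
    have "\<forall>\<^sub>F n in sequentially. real n \<ge> 2 * (norm z0 + d) + 2"
      using filterlim_real_sequentially unfolding filterlim_at_top by blast
    then show ?thesis
    proof (eventually_elim, intro ballI)
      fix n :: nat and s z
      assume n: "2 * (norm z0 + d) + 2 \<le> real n" and s: "s \<in> ball s0 d" and z: "z \<in> ball z0 d"
      define w where "w = z + of_nat n"
      have "norm z \<le> norm z0 + d"
        using z norm_triangle_ineq3[of z z0] by (simp add: dist_norm norm_minus_commute)
      moreover have "norm w \<ge> real n - norm z"
        using norm_triangle_ineq4[of w z] by (simp add: w_def)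
      ultimately have w: "norm w \<ge> real n / 2"
        using n d by argo
      have n2: "real n \<ge> 2"
        using n d norm_ge_zero[of z0] by argo
      have w0: "w \<noteq> 0"
        using w n2 by (metis divide_le_0_iff norm_zero not_numeral_le_zero order_trans zero_le_numeral)
      have Res: "Re s \<ge> 1 + d"
      proof -
        have "Re s0 - Re s \<le> d"
          using s abs_Re_le_cmod[of "s0 - s"] by (simp add: dist_norm)
        then show ?thesis by (simp add: d_def field_simps)
      qed
      have Ims: "\<bar>Im s\<bar> \<le> norm s0 + d"
        using s norm_triangle_ineq3[of s s0] abs_Im_le_cmod[of s]
        by (simp add: dist_norm norm_minus_commute)
      have ln: "ln (norm w) \<ge> ln (real n / 2)" "ln (real n / 2) \<ge> 0"
        using w n2 by (auto intro!: ln_mono)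
      have "Re (- s * Ln w) = - Re s * ln (norm w) + Im s * Im (Ln w)"
        using w0 by simp
      also have "\<dots> \<le> - (1 + d) * ln (real n / 2) + (norm s0 + d) * pi"
      proof -
        have "(1 + d) * ln (real n / 2) \<le> Re s * ln (norm w)"
          by (intro mult_mono Res ln) (use d Res ln in auto)
        moreover have "Im s * Im (Ln w) \<le> \<bar>Im s\<bar> * \<bar>Im (Ln w)\<bar>"
          by (metis abs_ge_self abs_mult)
        moreover have "\<bar>Im s\<bar> * \<bar>Im (Ln w)\<bar> \<le> (norm s0 + d) * pi"
          by (intro mult_mono Ims) (use mpi_less_Im_Ln[OF w0] Im_Ln_le_pi[OF w0] d in auto)
        ultimately show ?thesis by linarith
      qed
      finally have "norm (w powr (- s)) \<le> exp (- (1 + d) * ln (real n / 2) + (norm s0 + d) * pi)"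
        using w0 by (simp add: powr_def)
      also have "\<dots> = exp (pi * (norm s0 + d)) * (real n / 2) powr (- (1 + d))"
        using n2 by (simp add: powr_def exp_add[symmetric] algebra_simps)
      also have "\<dots> = h n"
        using n2 by (simp add: h_def powr_divide powr_minus_divide del: minus_add_distrib)
      finally show "norm ((z + of_nat n) powr (- s)) \<le> h n" by (simp add: w_def)
    qed
  qed
  ultimately show ?thesis using that d by blast
qed

text \<open>
  The factor \<open>s - 1\<close> removes the pole of the Hurwitz zeta function, so that its
  continuation is entire in \<open>s\<close>.
\<close>

definition zeta_reg_series :: "complex \<Rightarrow> complex \<Rightarrow> complex" where
  "zeta_reg_series s z = (s - 1) * (\<Sum>n. (z + of_nat n) powr (- s))"

lemma hurwitz_summable:
  assumes "Re s > 1"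
  shows "summable (\<lambda>n. (z + of_nat n) powr (- s))"
proof -
  obtain d h where d: "d > 0" "summable (h :: nat \<Rightarrow> real)" "\<And>n. h n \<ge> 0"
    "\<forall>\<^sub>F n in sequentially. \<forall>s\<in>ball s d. \<forall>z\<in>ball z d. norm ((z + of_nat n) powr (- s)) \<le> h n"
    using hurwitz_series_bound[OF assms, where ?z0.0 = z] by blast
  show ?thesis
    by (rule summable_comparison_test_ev[OF _ d(2)])
       (use d(1,4) in \<open>auto elim!: eventually_mono\<close>)
qed

lemma continuous_on_zeta_reg_series:
  "continuous_on ({s. Re s > 1} \<times> uhp) (\<lambda>(s, z). zeta_reg_series s z)"
proof -
  have "isCont (\<lambda>(s, z). zeta_reg_series s z) p" if p: "p \<in> {s. Re s > 1} \<times> uhp" for p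
  proof -
    obtain s0 z0 where p_eq: "p = (s0, z0)" by (cases p)
    have s0: "Re s0 > 1" and z0: "Im z0 > 0" using p by (auto simp: p_eq)
    obtain d h where d: "d > 0" "summable (h :: nat \<Rightarrow> real)" "\<And>n. h n \<ge> 0"
      "\<forall>\<^sub>F n in sequentially. \<forall>s\<in>ball s0 d. \<forall>z\<in>ball z0 d. norm ((z + of_nat n) powr (- s)) \<le> h n"
      using hurwitz_series_bound[OF s0, where ?z0.0 = z0] by blast
    define A where "A = (ball s0 d \<inter> {s. Re s > 1}) \<times> (ball z0 d \<inter> uhp)"
    have "open A" "p \<in> A"
      using d(1) s0 z0 by (auto simp: A_def p_eq intro!: open_Times open_Int open_halfspace_Re_gt open_halfspace_Im_gt)
    have "continuous_on A (\<lambda>p. \<Sum>n. (snd p + of_nat n) powr (- fst p))"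
    proof (rule uniform_limit_theorem)
      show "uniform_limit A (\<lambda>N p. \<Sum>n<N. (snd p + of_nat n) powr (- fst p))
          (\<lambda>p. \<Sum>n. (snd p + of_nat n) powr (- fst p)) sequentially"
        by (rule Weierstrass_m_test_ev[OF _ d(2)])
           (use d(4) in \<open>auto elim!: eventually_mono simp: A_def\<close>)
      show "\<forall>\<^sub>F N in sequentially. continuous_on A (\<lambda>p. \<Sum>n<N. (snd p + of_nat n) powr (- fst p))"
        by (intro always_eventually allI continuous_intros)
           (auto simp: A_def complex_eq_iff intro!: nonpos_Reals_uhp)
    qed simp
    then have "continuous_on A (\<lambda>(s, z). zeta_reg_series s z)"
      unfolding zeta_reg_series_def split_beta by (intro continuous_intros) auto
    with \<open>open A\<close> \<open>p \<in> A\<close> show ?thesis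
      using continuous_on_eq_continuous_at by blast
  qed
  then show ?thesis
    by (intro continuous_at_imp_continuous_on) auto
qed

lemma zeta_reg_series_holomorphic:
  assumes "Im z > 0"
  shows "(\<lambda>s. zeta_reg_series s z) holomorphic_on {s. Re s > 1}"
proof -
  have "\<exists>g g'. \<forall>s\<in>{s. Re s > 1}. (\<lambda>n. (z + of_nat n) powr (- s)) sums g s \<and>
      (\<lambda>n. - Ln (z + of_nat n) * (z + of_nat n) powr (- s)) sums g' s \<and>
      (g has_field_derivative g' s) (at s)"
  proof (rule series_and_derivative_comparison_local)
    show "open {s. Re s > 1}" by (rule open_halfspace_Re_gt)
    show "((\<lambda>s. (z + of_nat n) powr (- s)) has_field_derivative
        - Ln (z + of_nat n) * (z + of_nat n) powr (- s)) (at s)" if "s \<in> {s. Re s > 1}" for n s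
    proof -
      have "z + of_nat n \<noteq> 0"
        using assms by (auto simp: complex_eq_iff)
      then show ?thesis
        unfolding powr_def by (auto intro!: derivative_eq_intros)
    qed
    fix s assume "s \<in> {s. Re s > 1}"
    then have "Re s > 1" by simp
    obtain d h where "d > 0" "summable (h :: nat \<Rightarrow> real)" "\<And>n. h n \<ge> 0"
      "\<forall>\<^sub>F n in sequentially. \<forall>s\<in>ball s d. \<forall>z\<in>ball z d. norm ((z + of_nat n) powr (- s)) \<le> h n"
      using hurwitz_series_bound[OF \<open>Re s > 1\<close>, where ?z0.0 = z] by blast
    then show "\<exists>d h. 0 < d \<and> summable h \<and> (\<forall>\<^sub>F n in sequentially.
        \<forall>y\<in>ball s d \<inter> {s. Re s > 1}. norm ((z + of_nat n) powr (- y)) \<le> h n)"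
      by (intro exI[of _ d] exI[of _ h]) (auto elim!: eventually_mono)
  qed
  then obtain g g' where g: "\<And>s. Re s > 1 \<Longrightarrow> (\<lambda>n. (z + of_nat n) powr (- s)) sums g s"
      "\<And>s. Re s > 1 \<Longrightarrow> (g has_field_derivative g' s) (at s)"
    by blast
  have "g holomorphic_on {s. Re s > 1}"
    using g(2) by (auto simp: holomorphic_on_open open_halfspace_Re_gt)
  then have "(\<lambda>s. (s - 1) * g s) holomorphic_on {s. Re s > 1}"
    by (intro holomorphic_intros)
  then show ?thesis
    by (rule holomorphic_transform) (use g(1) in \<open>simp add: zeta_reg_series_def sums_iff\<close>)
qed

lemma zeta_reg_series_deriv:
  assumes s: "Re s > 1" and "Im z > 0"
  shows "(zeta_reg_series s has_field_derivative (1 - s) * zeta_reg_series (s + 1) z) (at z)"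
proof -
  have "\<exists>g g'. \<forall>z\<in>uhp. (\<lambda>n. (z + of_nat n) powr (- s)) sums g z \<and>
      (\<lambda>n. - s * (z + of_nat n) powr (- (s + 1))) sums g' z \<and>
      (g has_field_derivative g' z) (at z)"
  proof (rule series_and_derivative_comparison_local)
    show "open uhp" by (rule open_uhp)
    show "((\<lambda>z. (z + of_nat n) powr (- s)) has_field_derivative
        - s * (z + of_nat n) powr (- (s + 1))) (at z)" if "z \<in> uhp" for n z
      using that by (auto intro!: derivative_eq_intros nonpos_Reals_uhp)
    fix z assume "z \<in> uhp"
    obtain d h where "d > 0" "summable (h :: nat \<Rightarrow> real)" "\<And>n. h n \<ge> 0"
      "\<forall>\<^sub>F n in sequentially. \<forall>s\<in>ball s d. \<forall>z\<in>ball z d. norm ((z + of_nat n) powr (- s)) \<le> h n"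
      using hurwitz_series_bound[OF s, where ?z0.0 = z] by blast
    then show "\<exists>d h. 0 < d \<and> summable h \<and> (\<forall>\<^sub>F n in sequentially.
        \<forall>y\<in>ball z d \<inter> uhp. norm ((y + of_nat n) powr (- s)) \<le> h n)"
      by (intro exI[of _ d] exI[of _ h]) (auto elim!: eventually_mono)
  qed
  then obtain g g' where g: "\<And>z. z \<in> uhp \<Longrightarrow> (\<lambda>n. (z + of_nat n) powr (- s)) sums g z"
      "\<And>z. z \<in> uhp \<Longrightarrow> (\<lambda>n. - s * (z + of_nat n) powr (- (s + 1))) sums g' z"
      "\<And>z. z \<in> uhp \<Longrightarrow> (g has_field_derivative g' z) (at z)"
    by blast
  have z: "z \<in> uhp" using assms by simp
  have "s \<noteq> 0" using s by auto
  have "(\<lambda>n. (z + of_nat n) powr (- (s + 1))) sums (g' z / (- s))"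
    using sums_divide[OF g(2)[OF z], of "- s"] \<open>s \<noteq> 0\<close> by simp
  then have "(1 - s) * zeta_reg_series (s + 1) z = (s - 1) * g' z"
    using \<open>s \<noteq> 0\<close> by (simp add: zeta_reg_series_def sums_iff field_simps)
  moreover have "((\<lambda>z. (s - 1) * g z) has_field_derivative (s - 1) * g' z) (at z)"
    by (intro DERIV_cmult g z)
  ultimately have "((\<lambda>z. (s - 1) * g z) has_field_derivative (1 - s) * zeta_reg_series (s + 1) z) (at z)"
    by simp
  then show ?thesis
    by (rule has_field_derivative_transform_within_open[OF _ open_uhp z])
       (use g(1) in \<open>simp add: zeta_reg_series_def sums_iff\<close>)
qed

lemma zeta_reg_series_plus1:
  assumes "Re s > 1"
  shows "zeta_reg_series s (z + 1) = zeta_reg_series s z - (s - 1) * z powr (- s)"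
proof -
  have "(\<Sum>n. (z + 1 + of_nat n) powr (- s)) = (\<Sum>n. (z + of_nat n) powr (- s)) - z powr (- s)"
    using suminf_split_head[OF hurwitz_summable[OF assms, of z]] by (simp add: add_ac)
  then show ?thesis
    by (simp add: zeta_reg_series_def right_diff_distrib)
qed

section \<open>Continuation to the whole plane\<close>

text \<open>
  Stage \<open>k\<close> is meaningful for \<open>Re s > 1 - k\<close>. Each step integrates by parts once, expressing
  the function at \<open>s\<close> through its values at \<open>s + 1\<close>.
\<close>

primrec zeta_reg_upto :: "nat \<Rightarrow> complex \<Rightarrow> complex \<Rightarrow> complex" where
  "zeta_reg_upto 0 = zeta_reg_series"
| "zeta_reg_upto (Suc k) = (\<lambda>s z. z powr (1 - s) + (s - 1) *
     integral {0..1} (\<lambda>x. of_real (1 - x) * zeta_reg_upto k (s + 1) (z + of_real x)))"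

abbreviation Rgt :: "real \<Rightarrow> complex set" where "Rgt c \<equiv> {s. Re s > c}"

lemma open_Rgt: "open (Rgt c)" and convex_Rgt: "convex (Rgt c)"
  by (auto simp: open_halfspace_Re_gt convex_halfspace_Re_gt)

text \<open>
  The integral in the continuation step inherits joint continuity and holomorphy in \<open>s\<close> on a half
  plane that is larger by one unit. Joint continuity is carried along because it is what the
  interchange of integrals and the differentiation under the integral sign need.
\<close>

lemma shifted_mean_analytic:
  assumes G: "continuous_on (Rgt c \<times> uhp) (\<lambda>(s, z). G s z)"
    and hol: "\<And>z. Im z > 0 \<Longrightarrow> (\<lambda>s. G s z) holomorphic_on Rgt c"
  shows continuous_on_shifted_mean: "continuous_on (Rgt (c - 1) \<times> uhp)
      (\<lambda>(s, z). integral {0..1} (\<lambda>x. of_real (1 - x) * G (s + 1) (z + of_real x)))"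
    and shifted_mean_holomorphic: "Im z > 0 \<Longrightarrow>
      (\<lambda>s. integral {0..1} (\<lambda>x. of_real (1 - x) * G (s + 1) (z + of_real x))) holomorphic_on Rgt (c - 1)"
proof -
  let ?V = "Rgt (c - 1)"
  have cont: "continuous_on ((?V \<times> uhp) \<times> {0..1})
      (\<lambda>(p, x). of_real (1 - x) * G (fst p + 1) (snd p + of_real x))"
  proof -
    have "continuous_on ((?V \<times> uhp) \<times> {0..1})
       ((\<lambda>(s, z). G s z) \<circ> (\<lambda>(p, x). (fst p + 1, snd p + of_real x)))"
      unfolding split_beta
      by (intro continuous_on_compose continuous_on_subset[OF G[unfolded split_beta]] continuous_intros)
         auto
    then show ?thesis
      unfolding split_beta o_def by (intro continuous_intros) auto
  qed
  have "continuous_on (?V \<times> uhp) (\<lambda>p. integral (cbox 0 1)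
      (\<lambda>x. of_real (1 - x) * G (fst p + 1) (snd p + of_real x)))"
    by (rule integral_continuous_on_param) (use cont in simp)
  then show "continuous_on (Rgt (c - 1) \<times> uhp)
      (\<lambda>(s, z). integral {0..1} (\<lambda>x. of_real (1 - x) * G (s + 1) (z + of_real x)))"
    by (simp add: split_beta)
  show "(\<lambda>s. integral {0..1} (\<lambda>x. of_real (1 - x) * G (s + 1) (z + of_real x))) holomorphic_on ?V"
    if z: "Im z > 0"
  proof (rule holomorphic_on_integral_param[OF open_Rgt])
    have "continuous_on (?V \<times> {0..1})
      ((\<lambda>(p, x). of_real (1 - x) * G (fst p + 1) (snd p + of_real x)) \<circ> (\<lambda>(s, x). ((s, z), x)))"
      unfolding split_beta
      by (intro continuous_on_compose continuous_on_subset[OF cont[unfolded split_beta]] continuous_intros)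
         (use z in auto)
    then show "continuous_on (?V \<times> {0..1}) (\<lambda>(s, x). of_real (1 - x) * G (s + 1) (z + of_real x))"
      by (simp add: split_beta o_def)
    fix x :: real assume "x \<in> {0..1}"
    have "((\<lambda>s. G s (z + of_real x)) \<circ> (\<lambda>s. s + 1)) holomorphic_on ?V"
      by (rule holomorphic_on_compose_gen[OF _ hol])
         (use z in \<open>auto intro!: holomorphic_intros\<close>)
    then show "(\<lambda>s. of_real (1 - x) * G (s + 1) (z + of_real x)) holomorphic_on ?V"
      unfolding o_def by (intro holomorphic_intros) auto
  qed
qed

lemma zeta_reg_upto_analytic:
  shows continuous_on_zeta_reg_upto: "continuous_on (Rgt (1 - real k) \<times> uhp) (\<lambda>(s, z). zeta_reg_upto k s z)"
    and zeta_reg_upto_holomorphic: "Im z > 0 \<Longrightarrow> (\<lambda>s. zeta_reg_upto k s z) holomorphic_on Rgt (1 - real k)"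
proof (induction k arbitrary: z)
  case 0
  { case 1 show ?case using continuous_on_zeta_reg_series by simp }
  { case 2 then show ?case using zeta_reg_series_holomorphic by simp }
next
  case (Suc k)
  have k: "1 - real (Suc k) = 1 - real k - 1" by simp
  { case 1
    have "continuous_on (Rgt (1 - real k - 1) \<times> uhp) (\<lambda>p. snd p powr (1 - fst p))"
      by (intro continuous_intros) (auto intro!: nonpos_Reals_uhp)
    with continuous_on_shifted_mean[OF Suc.IH] show ?case
      unfolding split_beta zeta_reg_upto.simps k by (intro continuous_intros) auto }
  { case 2
    then have "z \<noteq> 0" by auto
    with shifted_mean_holomorphic[OF Suc.IH 2] show ?case
      unfolding zeta_reg_upto.simps k by (intro holomorphic_intros) auto }
qed

lemma continuous_on_zeta_reg_upto_z:
  assumes "Re s > 1 - real k"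
  shows "continuous_on uhp (zeta_reg_upto k s)"
proof -
  have "continuous_on uhp ((\<lambda>(s, z). zeta_reg_upto k s z) \<circ> (\<lambda>z. (s, z)))"
    unfolding split_beta
    by (intro continuous_on_compose continuous_on_subset[OF continuous_on_zeta_reg_upto[unfolded split_beta]] continuous_intros)
       (use assms in auto)
  then show ?thesis by (simp add: o_def)
qed

text \<open>
  Differentiation under the integral sign; the factors \<open>s - 1\<close> and \<open>- s\<close> combine so that the
  derivative is again of the form of the continuation step, now at \<open>s + 1\<close>.
\<close>

lemma zeta_reg_upto_deriv:
  assumes "Re s > 1 - real k" and "Im z > 0"
  shows "(zeta_reg_upto k s has_field_derivative (1 - s) * zeta_reg_upto k (s + 1) z) (at z)"
  using assms
proof (induction k arbitrary: s z)
  case 0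
  then show ?case using zeta_reg_series_deriv by simp
next
  case (Suc k)
  let ?f = "\<lambda>z x. of_real (1 - x) * zeta_reg_upto k (s + 1) (z + of_real x)"
  let ?fz = "\<lambda>z x. of_real (1 - x) * ((1 - (s + 1)) * zeta_reg_upto k (s + 1 + 1) (z + of_real x))"
  have k: "continuous_on (uhp \<times> {0..1}) (\<lambda>(z, x). zeta_reg_upto k t (z + of_real x))" if "Re t > 1 - real k" for t
  proof -
    have "continuous_on (uhp \<times> {0..1}) (zeta_reg_upto k t \<circ> (\<lambda>(z, x). z + of_real x))"
      unfolding split_beta
      by (intro continuous_on_compose continuous_on_subset[OF continuous_on_zeta_reg_upto_z[OF that]] continuous_intros) auto
    then show ?thesis by (simp add: split_beta o_def)
  qed
  have "((\<lambda>z. integral (cbox 0 1) (?f z)) has_field_derivative integral (cbox 0 1) (?fz z)) (at z within uhp)"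
  proof (rule leibniz_rule_field_derivative)
    show "continuous_on (uhp \<times> cbox 0 1) (\<lambda>(z, x). ?fz z x)"
      using k[of "s + 1 + 1"] Suc.prems unfolding split_beta
      by (intro continuous_intros) auto
    show "?f z integrable_on cbox 0 1" if "z \<in> uhp" for z
    proof -
      have "continuous_on {0..1} (\<lambda>x. zeta_reg_upto k (s + 1) (z + of_real x))"
        by (intro continuous_on_compose2[OF continuous_on_zeta_reg_upto_z[of k "s+1"]] continuous_intros)
           (use that Suc.prems in auto)
      then show ?thesis
        by (intro integrable_continuous continuous_intros) auto
    qed
    fix z and x :: real assume z: "z \<in> uhp" and x: "x \<in> cbox 0 1"
    have "(zeta_reg_upto k (s + 1) has_field_derivative (1 - (s + 1)) * zeta_reg_upto k (s + 1 + 1) (z + of_real x)) (at (z + of_real x))"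
      using Suc.prems z by (intro Suc.IH) auto
    then have "((\<lambda>z. zeta_reg_upto k (s + 1) (z + of_real x)) has_field_derivative (1 - (s + 1)) * zeta_reg_upto k (s + 1 + 1) (z + of_real x)) (at z)"
      by (simp only: DERIV_shift)
    then show "((\<lambda>z. ?f z x) has_field_derivative ?fz z x) (at z within uhp)"
      by (rule has_field_derivative_at_within[OF DERIV_cmult])
  qed (use Suc.prems convex_uhp in auto)
  then have "((\<lambda>z. integral {0..1} (?f z)) has_field_derivative integral {0..1} (?fz z)) (at z)"
    using Suc.prems by (simp add: at_within_open[OF _ open_uhp])
  then have "((\<lambda>z. z powr (1 - s) + (s - 1) * integral {0..1} (?f z)) has_field_derivative
      (1 - s) * z powr (1 - s - 1) + (s - 1) * integral {0..1} (?fz z)) (at z)"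
    using Suc.prems
    by (intro DERIV_add DERIV_cmult has_field_derivative_powr nonpos_Reals_uhp) auto
  moreover have "integral {0..1} (?fz z) =
      - s * integral {0..1} (\<lambda>x. of_real (1 - x) * zeta_reg_upto k (s + 1 + 1) (z + of_real x))"
    unfolding integral_mult_right[symmetric] by (intro integral_cong) (simp add: algebra_simps)
  ultimately show ?case
    by (simp add: algebra_simps)
qed

text \<open>
  Here the series itself provides a primitive of \<open>x \<mapsto> (1 - x) R(s + 1, z + x)\<close>, which involves
  \<open>R(s - 1, \<cdot>)\<close>; this is why \<open>Re s > 2\<close> is needed.
\<close>

lemma zeta_reg_upto_Suc_0:
  assumes "Re s > 2" "Im z > 0"
  shows "zeta_reg_upto 1 s z = zeta_reg_upto 0 s z"
proof -
  have s2: "s - 2 \<noteq> 0" using assms by auto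
  \<comment> \<open>a primitive of \<open>(s - 1) (1 - x) R(s + 1, w)\<close>, where \<open>w = z + x\<close>\<close>
  define A where "A w = zeta_reg_series (s - 1) w / (s - 2) - (1 - (w - z)) * zeta_reg_series s w" for w
  have "((\<lambda>x. (s - 1) * (of_real (1 - x) * zeta_reg_series (s + 1) (z + of_real x))) has_integral (A (z + of_real 1) - A (z + of_real 0))) {0..1}"
  proof (rule fundamental_theorem_of_calculus)
    fix x :: real assume "x \<in> {0..1}"
    let ?w = "z + of_real x"
    have "(zeta_reg_series (s - 1) has_field_derivative (1 - (s - 1)) * zeta_reg_series (s - 1 + 1) ?w) (at ?w)"
      "(zeta_reg_series s has_field_derivative (1 - s) * zeta_reg_series (s + 1) ?w) (at ?w)"
      by (rule zeta_reg_series_deriv; use assms in simp)+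
    then have "(A has_field_derivative (1 - (s - 1)) * zeta_reg_series (s - 1 + 1) ?w / (s - 2)
      - ((0 - (1 - 0)) * zeta_reg_series s ?w + (1 - s) * zeta_reg_series (s + 1) ?w * (1 - (?w - z)))) (at ?w)"
      unfolding A_def by (intro DERIV_diff DERIV_mult DERIV_cdivide DERIV_const DERIV_ident)
    also have "(1 - (s - 1)) * zeta_reg_series (s - 1 + 1) ?w / (s - 2)
      - ((0 - (1 - 0)) * zeta_reg_series s ?w + (1 - s) * zeta_reg_series (s + 1) ?w * (1 - (?w - z))) = 
      (s - 1) * (of_real (1 - x) * zeta_reg_series (s + 1) ?w)"
    proof -
      have "(1 - (s - 1)) * zeta_reg_series (s - 1 + 1) ?w / (s - 2) = - zeta_reg_series s ?w"
        using s2 by (simp add: divide_eq_eq) (simp add: algebra_simps)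
      then show ?thesis by (simp add: algebra_simps)
    qed
    finally have "((\<lambda>x. A (z + x)) has_field_derivative (s - 1) * (of_real (1 - x) * zeta_reg_series (s + 1) ?w)) (at (of_real x))"
      unfolding add.commute[of z] DERIV_shift .
    then show "((\<lambda>x. A (z + of_real x)) has_vector_derivative (s - 1) * (of_real (1 - x) * zeta_reg_series (s + 1) ?w)) (at x within {0..1})"
      by (rule has_vector_derivative_at_within[OF has_vector_derivative_real_field])
  qed simp
  then have "(s - 1) * integral {0..1} (\<lambda>x. of_real (1 - x) * zeta_reg_series (s + 1) (z + of_real x)) = A (z + 1) - A z"
    by (simp add: integral_unique flip: integral_mult_right)
  moreover have "A (z + 1) - A z = zeta_reg_series s z - z powr (1 - s)"
  proof -
    have "zeta_reg_series (s - 1) (z + 1) = zeta_reg_series (s - 1) z - (s - 2) * z powr (1 - s)"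
      using zeta_reg_series_plus1[of "s - 1" z] assms by simp
    then have "zeta_reg_series (s - 1) (z + 1) / (s - 2) = zeta_reg_series (s - 1) z / (s - 2) - z powr (1 - s)"
      using s2 by (simp add: diff_divide_distrib)
    then show ?thesis by (simp add: A_def)
  qed
  ultimately show ?thesis by simp
qed

lemma zeta_reg_upto_Suc:
  assumes "Re s > 2 - real k" "Im z > 0"
  shows "zeta_reg_upto (Suc k) s z = zeta_reg_upto k s z"
  using assms
proof (induction k arbitrary: s z)
  case 0
  then show ?case using zeta_reg_upto_Suc_0[of s z] by simp
next
  case (Suc k)
  have "zeta_reg_upto (Suc k) (s + 1) (z + of_real x) = zeta_reg_upto k (s + 1) (z + of_real x)" for x
    using Suc.prems by (intro Suc.IH) auto
  then show ?case
    by (subst (1 2) zeta_reg_upto.simps(2)) (simp only:)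
qed

text \<open>
  \<open>(s - 1) \<zeta>(s, z)\<close>. The number of steps is chosen large enough to reach \<open>s\<close>; more steps
  give the same value.
\<close>

definition zeta_reg :: "complex \<Rightarrow> complex \<Rightarrow> complex" where
  "zeta_reg s z = zeta_reg_upto (nat \<lceil>3 - Re s\<rceil>) s z"

lemma zeta_reg_eq_zeta_reg_upto:
  assumes "Re s > 2 - real k" "Im z > 0"
  shows "zeta_reg s z = zeta_reg_upto k s z"
proof -
  have *: "zeta_reg_upto (j + i) s z = zeta_reg_upto j s z" if "Re s > 2 - real j" for i j
    by (induction i) (use that assms(2) in \<open>simp_all add: zeta_reg_upto_Suc del: zeta_reg_upto.simps\<close>)
  define j where "j = nat \<lceil>3 - Re s\<rceil>"
  have j: "Re s > 2 - real j" unfolding j_def by linarith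
  have "zeta_reg_upto j s z = zeta_reg_upto k s z"
    using *[OF j, of "k - j"] *[OF assms(1), of "j - k"]
    by (cases "j \<le> k") (simp_all del: zeta_reg_upto.simps)
  then show ?thesis by (simp only: zeta_reg_def j_def)
qed

lemma ex_nat_Re: "\<exists>k. Re s > c - real k"
  using reals_Archimedean2[of "c - Re s"] by (auto simp: algebra_simps)

lemma zeta_reg_holomorphic:
  assumes "Im z > 0"
  shows "(\<lambda>s. zeta_reg s z) holomorphic_on UNIV"
proof -
  have "\<exists>g'. ((\<lambda>s. zeta_reg s z) has_field_derivative g') (at s)" for s
  proof -
    obtain k where k: "Re s > 2 - real k" using ex_nat_Re by blast
    have "(\<lambda>s. zeta_reg_upto k s z) holomorphic_on Rgt (2 - real k)"
      by (rule holomorphic_on_subset[OF zeta_reg_upto_holomorphic[OF assms]]) auto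
    then have "(\<lambda>s. zeta_reg s z) holomorphic_on Rgt (2 - real k)"
      by (rule holomorphic_transform) (use assms in \<open>simp add: zeta_reg_eq_zeta_reg_upto[of k]\<close>)
    with k show ?thesis
      by (auto simp: holomorphic_on_open[OF open_Rgt])
  qed
  then show ?thesis by (simp add: holomorphic_on_open)
qed

lemma zeta_reg_deriv:
  assumes "Im z > 0"
  shows "(zeta_reg s has_field_derivative (1 - s) * zeta_reg (s + 1) z) (at z)"
proof -
  obtain k where k: "Re s > 2 - real k" using ex_nat_Re by blast
  have "(zeta_reg_upto k s has_field_derivative (1 - s) * zeta_reg_upto k (s + 1) z) (at z)"
    by (rule zeta_reg_upto_deriv) (use k assms in auto)
  also have "zeta_reg_upto k (s + 1) z = zeta_reg (s + 1) z"
    using k assms by (simp add: zeta_reg_eq_zeta_reg_upto[of k])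
  finally show ?thesis
    by (rule has_field_derivative_transform_within_open[OF _ open_uhp])
       (use assms k in \<open>auto simp: zeta_reg_eq_zeta_reg_upto[of k]\<close>)
qed

lemma continuous_on_zeta_reg: "continuous_on uhp (zeta_reg s)"
  by (auto intro!: continuous_at_imp_continuous_on DERIV_isCont[OF zeta_reg_deriv])

lemma zeta_reg_rec:
  assumes "Im z > 0"
  shows "zeta_reg s z = z powr (1 - s) + (s - 1) *
    integral {0..1} (\<lambda>x. of_real (1 - x) * zeta_reg (s + 1) (z + of_real x))"
proof -
  obtain k where k: "Re s > 2 - real k" using ex_nat_Re by blast
  have "zeta_reg s z = zeta_reg_upto (Suc k) s z"
    using k assms by (intro zeta_reg_eq_zeta_reg_upto) auto
  moreover have "zeta_reg_upto k (s + 1) (z + of_real x) = zeta_reg (s + 1) (z + of_real x)" for x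
    using k assms by (simp add: zeta_reg_eq_zeta_reg_upto[of k])
  ultimately show ?thesis by simp
qed

text \<open>
  The construction gives the agreement with the series only for \<open>Re s > 2\<close>; the identity theorem
  in \<open>s\<close> extends it.
\<close>

lemma zeta_reg_eq_zeta_reg_series:
  assumes s: "Re s > 1" and z: "Im z > 0"
  shows "zeta_reg s z = zeta_reg_series s z"
proof (rule analytic_continuation_open[of "Rgt 2" "Rgt 1" "\<lambda>s. zeta_reg s z" "\<lambda>s. zeta_reg_series s z"])
  show "Rgt 2 \<noteq> {}" by (auto intro!: exI[of _ 3])
  show "zeta_reg s z = zeta_reg_series s z" if "s \<in> Rgt 2" for s
    using that zeta_reg_eq_zeta_reg_upto[of 0 s z] z by simp
qed (use assms zeta_reg_holomorphic[OF z] zeta_reg_series_holomorphic[OF z] in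
      \<open>auto intro: open_Rgt convex_connected convex_Rgt holomorphic_on_subset\<close>)

lemma zeta_reg_plus1:
  assumes z: "Im z > 0"
  shows "zeta_reg s (z + 1) = zeta_reg s z - (s - 1) * z powr (- s)"
proof (rule analytic_continuation_open[of "Rgt 1" UNIV "\<lambda>s. zeta_reg s (z + 1)" "\<lambda>s. zeta_reg s z - (s - 1) * z powr (- s)"])
  have "z \<noteq> 0" using z by auto
  then show "(\<lambda>s. zeta_reg s z - (s - 1) * z powr (- s)) holomorphic_on UNIV"
    by (intro holomorphic_intros zeta_reg_holomorphic z)
  show "(\<lambda>s. zeta_reg s (z + 1)) holomorphic_on UNIV"
    by (intro zeta_reg_holomorphic) (use z in auto)
  show "Rgt 1 \<noteq> {}" by (auto intro!: exI[of _ 3])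
  show "zeta_reg s (z + 1) = zeta_reg s z - (s - 1) * z powr (- s)" if "s \<in> Rgt 1" for s
    using that z by (simp add: zeta_reg_eq_zeta_reg_series zeta_reg_series_plus1)
qed (auto intro: open_Rgt)

lemma zeta_reg_1: "Im z > 0 \<Longrightarrow> zeta_reg 1 z = 1"
  by (subst zeta_reg_rec) (auto simp: powr_def)

text \<open>
  The negative of the digamma function, in the form in which it arises as the constant term of
  \<open>\<zeta>(s, z)\<close> at \<open>s = 1\<close>.
\<close>

definition neg_digamma :: "complex \<Rightarrow> complex" where
  "neg_digamma z = integral {0..1} (\<lambda>x. of_real (1 - x) * zeta_reg 2 (z + of_real x)) - Ln z"

lemma zeta_reg_deriv_1:
  assumes z: "Im z > 0"
  shows "((\<lambda>s. zeta_reg s z) has_field_derivative neg_digamma z) (at 1)"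
proof -
  \<comment> \<open>one continuation step suffices to describe the function near \<open>s = 1\<close>\<close>
  define J where "J s = integral {0..1} (\<lambda>x. of_real (1 - x) * zeta_reg_upto 1 (s + 1) (z + of_real x))" for s
  have "J holomorphic_on Rgt (0 - 1)"
    unfolding J_def
    by (rule shifted_mean_holomorphic[OF _ _ z])
       (use continuous_on_zeta_reg_upto[of 1] zeta_reg_upto_holomorphic[of _ 1] in auto)
  then have J': "(J has_field_derivative deriv J 1) (at 1)"
    by (rule holomorphic_derivI[OF _ open_Rgt]) simp
  have hzJ: "zeta_reg s z = z powr (1 - s) + (s - 1) * J s" if "s \<in> Rgt 0" for s
    unfolding zeta_reg_rec[OF z, of s] J_def using that z zeta_reg_eq_zeta_reg_upto[of 1 "s + 1"] by simp
  have J1: "J 1 = integral {0..1} (\<lambda>x. of_real (1 - x) * zeta_reg 2 (z + of_real x))"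
    unfolding J_def using z zeta_reg_eq_zeta_reg_upto[of 1 2] by simp
  have "z \<noteq> 0" using z by auto
  then have "((\<lambda>s. z powr (1 - s)) has_field_derivative - Ln z) (at 1)"
    unfolding powr_def by (auto intro!: derivative_eq_intros)
  then have "((\<lambda>s. z powr (1 - s) + (s - 1) * J s) has_field_derivative - Ln z + ((1 - 0) * J 1 + deriv J 1 * (1 - 1))) (at 1)"
    by (intro DERIV_add DERIV_mult DERIV_diff DERIV_ident DERIV_const J')
  then have "((\<lambda>s. z powr (1 - s) + (s - 1) * J s) has_field_derivative neg_digamma z) (at 1)"
    by (simp add: neg_digamma_def J1)
  then show ?thesis
    by (rule has_field_derivative_transform_within_open[OF _ open_Rgt[of 0]]) (use hzJ in auto)
qed

text \<open>
  The \<open>s\<close>-derivative at \<open>1\<close> of the translation formula for \<open>(s - 1) \<zeta>(s, z)\<close>.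
\<close>

lemma neg_digamma_plus1:
  assumes z: "Im z > 0"
  shows "neg_digamma (z + 1) = neg_digamma z - 1 / z"
proof -
  have "z \<noteq> 0" using z by auto
  then have "((\<lambda>s. zeta_reg s z - (s - 1) * z powr (- s)) has_field_derivative neg_digamma z - 1 / z) (at 1)"
    using zeta_reg_deriv_1[OF z] by (auto intro!: derivative_eq_intros simp: powr_minus field_simps)
  moreover have "((\<lambda>s. zeta_reg s z - (s - 1) * z powr (- s)) has_field_derivative neg_digamma (z + 1)) (at 1)"
    using zeta_reg_deriv_1[of "z + 1"] z by (simp add: zeta_reg_plus1)
  ultimately show ?thesis by (rule DERIV_unique[symmetric])
qed

text \<open>
  After differentiating under the integral sign, the continuation step at \<open>s = 2\<close> identifies the
  result as \<open>- \<zeta>(2, z)\<close>.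
\<close>

lemma neg_digamma_deriv:
  assumes z: "Im z > 0"
  shows "(neg_digamma has_field_derivative - zeta_reg 2 z) (at z)"
proof -
  let ?f = "\<lambda>z x. of_real (1 - x) * zeta_reg 2 (z + of_real x)"
  let ?fz = "\<lambda>z x. of_real (1 - x) * ((1 - 2) * zeta_reg (2 + 1) (z + of_real x))"
  have k: "continuous_on (uhp \<times> {0..1}) (\<lambda>(z, x). zeta_reg t (z + of_real x))" for t
  proof -
    have "continuous_on (uhp \<times> {0..1}) (zeta_reg t \<circ> (\<lambda>(z, x). z + of_real x))"
      unfolding split_beta
      by (intro continuous_on_compose continuous_on_subset[OF continuous_on_zeta_reg] continuous_intros) auto
    then show ?thesis by (simp add: split_beta o_def)
  qed
  have "((\<lambda>z. integral (cbox 0 1) (?f z)) has_field_derivative integral (cbox 0 1) (?fz z)) (at z within uhp)"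
  proof (rule leibniz_rule_field_derivative)
    show "continuous_on (uhp \<times> cbox 0 1) (\<lambda>(z, x). ?fz z x)"
      using k[of "2 + 1"] unfolding split_beta by (intro continuous_intros) auto
    show "?f z integrable_on cbox 0 1" if "z \<in> uhp" for z
    proof -
      have "continuous_on {0..1} (\<lambda>x. zeta_reg 2 (z + of_real x))"
        by (intro continuous_on_compose2[OF continuous_on_zeta_reg] continuous_intros) (use that in auto)
      then show ?thesis
        by (intro integrable_continuous continuous_intros) auto
    qed
    fix z and x :: real assume z: "z \<in> uhp" and x: "x \<in> cbox 0 1"
    have "(zeta_reg 2 has_field_derivative (1 - 2) * zeta_reg (2 + 1) (z + of_real x)) (at (z + of_real x))"
      using z by (intro zeta_reg_deriv) auto
    then have "((\<lambda>z. zeta_reg 2 (z + of_real x)) has_field_derivative (1 - 2) * zeta_reg (2 + 1) (z + of_real x)) (at z)"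
      by (simp only: DERIV_shift)
    then show "((\<lambda>z. ?f z x) has_field_derivative ?fz z x) (at z within uhp)"
      by (rule has_field_derivative_at_within[OF DERIV_cmult])
  qed (use z convex_uhp in auto)
  then have "((\<lambda>z. integral {0..1} (?f z)) has_field_derivative integral {0..1} (?fz z)) (at z)"
    using z by (simp add: at_within_open[OF _ open_uhp])
  then have "(neg_digamma has_field_derivative integral {0..1} (?fz z) - inverse z) (at z)"
    unfolding neg_digamma_def[abs_def]
    by (rule DERIV_diff) (use z in \<open>auto intro!: has_field_derivative_Ln nonpos_Reals_uhp\<close>)
  moreover have "zeta_reg 2 z = inverse z + integral {0..1} (\<lambda>x. of_real (1 - x) * zeta_reg (2 + 1) (z + of_real x))"
    using zeta_reg_rec[OF z, of 2] z by (simp add: powr_minus)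
  then have "integral {0..1} (?fz z) - inverse z = - zeta_reg 2 z"
    by simp
  ultimately show ?thesis by (simp only:)
qed

section \<open>The constant term of the Hurwitz zeta function\<close>

text \<open>
  The two functions agree outside a sparse set by the identity theorem. At the remaining points
  both have a pole, with the conventional value 0, or both are continuous.
\<close>

lemma nicely_meromorphic_unique:
  assumes f: "f nicely_meromorphic_on UNIV" and g: "g nicely_meromorphic_on UNIV"
    and S: "open S" "S \<noteq> {}" and eq: "\<And>z. z \<in> S \<Longrightarrow> f z = g z"
  shows "f = g"
proof
  fix x
  have "(\<lambda>z. f z - g z) meromorphic_on UNIV"
    using f g by (auto simp: nicely_meromorphic_on_def intro!: meromorphic_intros)
  then have "(\<forall>\<^sub>\<approx>z\<in>UNIV. f z - g z = 0) \<or> (\<forall>\<^sub>\<approx>z\<in>UNIV. f z - g z \<noteq> 0)"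
    by (intro meromorphic_imp_constant_or_avoid) auto
  moreover have "\<not> (\<forall>\<^sub>\<approx>z\<in>UNIV. f z - g z \<noteq> 0)"
  proof
    assume *: "\<forall>\<^sub>\<approx>z\<in>UNIV. f z - g z \<noteq> 0"
    obtain y where y: "y \<in> S" using S by auto
    have "\<forall>\<^sub>F z in at y. f z - g z \<noteq> 0"
      using * by (simp add: eventually_cosparse_open_eq)
    moreover have "\<forall>\<^sub>F z in at y. z \<in> S"
      using S y by (simp add: eventually_at_in_open')
    ultimately have "\<forall>\<^sub>F z in at y. False"
      by eventually_elim (use eq in auto)
    then show False by simp
  qed
  ultimately have "\<forall>\<^sub>\<approx>z\<in>UNIV. f z - g z = 0"
    by blast
  then have ev: "\<forall>\<^sub>F z in at x. f z = g z"
    by (simp add: eventually_cosparse_open_eq)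
  have pole: "is_pole f x \<longleftrightarrow> is_pole g x"
    by (rule is_pole_cong[OF ev refl])
  have nf: "is_pole f x \<and> f x = 0 \<or> f \<midarrow>x\<rightarrow> f x" and ng: "is_pole g x \<and> g x = 0 \<or> g \<midarrow>x\<rightarrow> g x"
    using f g by (auto simp: nicely_meromorphic_on_def)
  show "f x = g x"
  proof (cases "is_pole f x")
    case True
    then have "\<not> f \<midarrow>x\<rightarrow> c" "\<not> g \<midarrow>x\<rightarrow> c" for c
      using pole is_pole_def not_tendsto_and_filterlim_at_infinity[of "at x"] by auto
    then show ?thesis using nf ng by auto
  next
    case False
    then have "f \<midarrow>x\<rightarrow> f x" "g \<midarrow>x\<rightarrow> g x" using pole nf ng by auto
    moreover have "f \<midarrow>x\<rightarrow> g x"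
      using \<open>g \<midarrow>x\<rightarrow> g x\<close> ev by (subst tendsto_cong) auto
    ultimately show ?thesis by (metis LIM_unique)
  qed
qed

lemma hurwitz_zeta_eq:
  assumes z: "Im z > 0"
  shows "hurwitz_zeta s z = (if s = 1 then 0 else zeta_reg s z / (s - 1))"
proof -
  define g where "g = (\<lambda>s. if s = 1 then 0 else zeta_reg s z / (s - 1))"
  have hol: "(\<lambda>s. zeta_reg s z / (s - 1)) holomorphic_on - {1}"
    by (intro holomorphic_intros holomorphic_on_subset[OF zeta_reg_holomorphic[OF z]]) auto
  have an: "g analytic_on - {1}"
  proof (subst analytic_on_open)
    show "g holomorphic_on - {1}"
      by (rule holomorphic_transform[OF hol]) (simp add: g_def)
  qed auto
  have "is_pole (\<lambda>s. zeta_reg s z / (s - 1)) 1"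
  proof (rule is_pole_divide)
    show "isCont (\<lambda>s. zeta_reg s z) 1"
      using zeta_reg_deriv_1[OF z] by (rule DERIV_isCont)
    show "filterlim (\<lambda>s::complex. s - 1) (at 0) (at 1)"
      by (auto simp: filterlim_at eventually_at_filter intro!: tendsto_eq_intros)
    show "zeta_reg 1 z \<noteq> 0" using z by (simp add: zeta_reg_1)
  qed
  then have pole: "is_pole g 1"
    by (rule is_pole_cong[THEN iffD1, rotated -1])
       (auto simp: g_def eventually_at_filter)
  have nice: "g nicely_meromorphic_on UNIV"
  proof (rule nicely_meromorphic_onI_open[where pts = "{1}"])
    show "g analytic_on UNIV - {1}" using an by (simp add: Compl_eq_Diff_UNIV)
    show "isolated_singularity_at g x" for x
      unfolding isolated_singularity_at_def
      by (intro exI[of _ "if x = 1 then 1 else dist x 1"]) 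
         (auto intro!: analytic_on_subset[OF an] simp: dist_commute)
  qed (use pole in \<open>auto simp: g_def\<close>)
  have sums: "(\<lambda>n. (z + of_nat n) powr (- s)) sums g s" if "Re s > 1" for s
  proof -
    have "s \<noteq> 1" using that by auto
    then have "g s = (\<Sum>n. (z + of_nat n) powr (- s))"
      using that z by (simp add: g_def zeta_reg_eq_zeta_reg_series zeta_reg_series_def)
    then show ?thesis using hurwitz_summable[OF that, of z] by (simp add: sums_iff)
  qed
  have "(THE g. g nicely_meromorphic_on UNIV \<and>
      (\<forall>s. Re s > 1 \<longrightarrow> (\<lambda>n. (z + of_nat n) powr (- s)) sums g s)) = g"
  proof (rule the_equality)
    fix h assume h: "h nicely_meromorphic_on UNIV \<and>
      (\<forall>s. Re s > 1 \<longrightarrow> (\<lambda>n. (z + of_nat n) powr (- s)) sums h s)"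
    show "h = g"
      by (rule nicely_meromorphic_unique[of h g "Rgt 1"])
         (use h nice sums in \<open>auto simp: sums_iff open_halfspace_Re_gt intro!: exI[of _ 2]\<close>)
  qed (use nice sums in blast)
  then show ?thesis by (simp add: hurwitz_zeta_def g_def)
qed

lemma zeta_star_eq:
  assumes z: "Im z > 0"
  shows "zeta_star a z = (if a = 1 then neg_digamma z else zeta_reg a z / (a - 1))"
proof (cases "a = 1")
  case False
  have "(\<lambda>s. zeta_reg s z / (s - 1)) holomorphic_on - {1}"
    by (intro holomorphic_intros holomorphic_on_subset[OF zeta_reg_holomorphic[OF z]]) auto
  then have "(\<lambda>s. hurwitz_zeta s z) holomorphic_on - {1}"
    by (rule holomorphic_transform) (use z in \<open>auto simp: hurwitz_zeta_eq\<close>)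
  then have "(\<lambda>s. hurwitz_zeta s z) analytic_on - {1}"
    by (subst analytic_on_open) auto
  then have "(\<lambda>s. hurwitz_zeta s z) analytic_on {a}"
    using False by (auto intro: analytic_on_subset)
  then have "(\<lambda>w. hurwitz_zeta (a + w) z) has_fps_expansion fps_expansion (\<lambda>s. hurwitz_zeta s z) a"
    by (rule analytic_at_imp_has_fps_expansion)
  then have "laurent_expansion (\<lambda>s. hurwitz_zeta s z) a = fps_to_fls (fps_expansion (\<lambda>s. hurwitz_zeta s z) a)"
    by (intro laurent_expansion_eqI) (simp add: has_fps_expansion_to_laurent)
  then show ?thesis
    using False z by (simp add: zeta_star_def fps_expansion_def hurwitz_zeta_eq)
next
  case True
  let ?F = "fps_expansion (\<lambda>s. zeta_reg s z) 1"
  have "(\<lambda>s. zeta_reg s z) analytic_on {1}"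
    using zeta_reg_holomorphic[OF z] by (meson analytic_on_holomorphic open_UNIV subset_UNIV)
  then have "(\<lambda>w. zeta_reg (1 + w) z) has_fps_expansion ?F"
    by (rule analytic_at_imp_has_fps_expansion)
  then have "(\<lambda>w. zeta_reg (1 + w) z / w) has_laurent_expansion fps_to_fls ?F / fls_X"
    by (intro laurent_expansion_intros) (simp add: has_fps_expansion_to_laurent)
  then have "(\<lambda>w. hurwitz_zeta (1 + w) z) has_laurent_expansion fps_to_fls ?F / fls_X"
    by (rule has_laurent_expansion_cong[THEN iffD1, rotated -1])
       (use z in \<open>auto simp: hurwitz_zeta_eq eventually_at_filter\<close>)
  then have "laurent_expansion (\<lambda>s. hurwitz_zeta s z) 1 = fps_to_fls ?F / fls_X"
    by (rule laurent_expansion_eqI)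
  then show ?thesis
    using True z zeta_reg_deriv_1[OF z]
    by (simp add: zeta_star_def fps_expansion_def fls_divide_X DERIV_imp_deriv)
qed

section \<open>The generalised exponential integral\<close>

lemma has_integral_atLeast_FTC:
  fixes F f :: "real \<Rightarrow> complex"
  assumes F: "\<And>t. t \<ge> a \<Longrightarrow> (F has_vector_derivative f t) (at t)"
    and f: "f absolutely_integrable_on {a..}" and L: "(F \<longlongrightarrow> L) at_top"
  shows "(f has_integral (L - F a)) {a..}"
proof -
  have "((\<lambda>b. set_lebesgue_integral lebesgue {a..b} f) \<longlongrightarrow> set_lebesgue_integral lebesgue {a..} f) at_top"
    by (rule tendsto_set_lebesgue_integral_at_top) (use f in auto)
  moreover have "\<forall>\<^sub>F b in at_top. set_lebesgue_integral lebesgue {a..b} f = F b - F a"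
    using eventually_ge_at_top[of a]
  proof eventually_elim
    case (elim b)
    have "f absolutely_integrable_on {a..b}"
      by (rule set_integrable_subset[OF f]) auto
    then have "set_lebesgue_integral lebesgue {a..b} f = integral {a..b} f"
      by (rule set_lebesgue_integral_eq_integral)
    also have "(f has_integral (F b - F a)) {a..b}"
      by (rule fundamental_theorem_of_calculus)
         (use elim F in \<open>auto intro: has_vector_derivative_at_within\<close>)
    then have "integral {a..b} f = F b - F a" by (rule integral_unique)
    finally show ?case .
  qed
  ultimately have "((\<lambda>b. F b - F a) \<longlongrightarrow> integral {a..} f) at_top"
    using set_lebesgue_integral_eq_integral(2)[OF f] by (simp add: tendsto_cong)
  moreover have "((\<lambda>b. F b - F a) \<longlongrightarrow> L - F a) at_top"
    by (intro tendsto_intros L)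
  ultimately have "integral {a..} f = L - F a"
    by (rule tendsto_unique[rotated]) simp
  with set_lebesgue_integral_eq_integral(1)[OF f] show ?thesis
    by (simp add: has_integral_integrable_integral)
qed

text \<open>
  Follows from \<open>ln (\<epsilon> t) \<le> \<epsilon> t - 1\<close> with \<open>\<epsilon>\<close> small enough that \<open>\<bar>\<sigma>\<bar> \<epsilon> \<le> \<delta>\<close>.
\<close>

lemma powr_le_exp:
  fixes \<delta> \<sigma> :: real
  assumes "\<delta> > 0"
  obtains C where "\<And>t. t \<ge> 1 \<Longrightarrow> t powr \<sigma> \<le> C * exp (\<delta> * t)"
proof
  define \<epsilon> where "\<epsilon> = \<delta> / (\<bar>\<sigma>\<bar> + 1)"
  have \<epsilon>: "\<epsilon> > 0" using assms by (simp add: \<epsilon>_def)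
  fix t :: real assume t: "t \<ge> 1"
  have "\<sigma> * ln t \<le> \<bar>\<sigma>\<bar> * ln t" using t by (intro mult_right_mono) auto
  also have "\<dots> \<le> \<bar>\<sigma>\<bar> * (\<epsilon> * t - 1 - ln \<epsilon>)"
    using ln_le_minus_one[of "\<epsilon> * t"] \<epsilon> t by (intro mult_left_mono) (auto simp: ln_mult)
  also have "\<dots> = \<bar>\<sigma>\<bar> * \<epsilon> * t + \<bar>\<sigma>\<bar> * (- 1 - ln \<epsilon>)" by (simp add: algebra_simps)
  also have "\<bar>\<sigma>\<bar> * \<epsilon> * t \<le> \<delta> * t"
    using t assms by (intro mult_right_mono) (auto simp: \<epsilon>_def field_simps)
  finally have "exp (\<sigma> * ln t) \<le> exp (\<bar>\<sigma>\<bar> * (- 1 - ln \<epsilon>) + \<delta> * t)" by simp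
  then show "t powr \<sigma> \<le> exp (\<bar>\<sigma>\<bar> * (- 1 - ln \<epsilon>)) * exp (\<delta> * t)"
    using t by (simp add: powr_def exp_add)
qed

lemma norm_exp_powr:
  fixes t :: real
  assumes "t > 0"
  shows "norm (exp (- z * of_real t) * of_real t powr (- s)) = exp (- Re z * t) * t powr (- Re s)"
  using assms by (simp add: norm_mult norm_powr_real_powr)

lemma expint_absolutely_integrable:
  assumes z: "Re z > 0"
  shows "(\<lambda>t. exp (- z * of_real t) * of_real t powr (- s)) absolutely_integrable_on {1..}"
proof -
  obtain C where C: "\<And>t. t \<ge> 1 \<Longrightarrow> t powr (- Re s) \<le> C * exp (Re z / 2 * t)"
    using powr_le_exp[of "Re z / 2" "- Re s"] z by auto
  show ?thesis
  proof (rule measurable_bounded_by_integrable_imp_absolutely_integrable)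
    show "(\<lambda>t. exp (- z * of_real t) * of_real t powr (- s)) \<in> borel_measurable (lebesgue_on {1..})"
      by (intro continuous_imp_measurable_on_sets_lebesgue continuous_intros) auto
    show "(\<lambda>t. C * exp (- (Re z / 2) * t)) integrable_on {1..}"
      using z by (intro integrable_on_mult_right integrable_on_exp_minus_to_infinity) auto
    fix t :: real assume t: "t \<in> {1..}"
    have "exp (- Re z * t) * t powr (- Re s) \<le> exp (- Re z * t) * (C * exp (Re z / 2 * t))"
      using C t by (intro mult_left_mono) auto
    also have "\<dots> = C * exp (- (Re z / 2) * t)"
      by (simp add: exp_add[symmetric] mult.left_commute)
    finally show "norm (exp (- z * of_real t) * of_real t powr (- s)) \<le> C * exp (- (Re z / 2) * t)"
      using t by (subst norm_exp_powr) auto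
  qed auto
qed

text \<open>
  The integral that defines \<open>E\<^sub>s(z)\<close> on the right half-plane.
\<close>

definition expint_J :: "complex \<Rightarrow> complex \<Rightarrow> complex" where
  "expint_J s z = integral {1..} (\<lambda>t. exp (- z * of_real t) * of_real t powr (- s))"

text \<open>
  Integration by parts: \<open>- exp (- z t) t powr (- s)\<close> vanishes at infinity.
\<close>

lemma expint_J_rec:
  assumes z: "Re z > 0"
  shows "z * expint_J s z = exp (- z) - s * expint_J (s + 1) z"
proof -
  let ?f = "\<lambda>s t. exp (- z * of_real t) * of_real t powr (- s)"
  have int: "(\<lambda>t. z * ?f s t + s * ?f (s + 1) t) absolutely_integrable_on {1..}"
    by (intro set_integral_add set_integrable_mult_right expint_absolutely_integrable z)
  have "((\<lambda>t. z * ?f s t + s * ?f (s + 1) t) has_integral (0 - (- ?f s 1))) {1..}"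
  proof (rule has_integral_atLeast_FTC[OF _ int])
    fix t :: real assume t: "t \<ge> 1"
    have "((\<lambda>w. - (exp (- z * w) * w powr (- s))) has_field_derivative
        z * ?f s t + s * ?f (s + 1) t) (at (of_real t))"
    proof -
      have *: "- 1 - s = - s - 1" by simp
      show ?thesis
        using t by (auto intro!: derivative_eq_intros simp: algebra_simps *)
    qed
    then show "((\<lambda>t. - ?f s t) has_vector_derivative z * ?f s t + s * ?f (s + 1) t) (at t)"
      by (rule has_vector_derivative_real_field)
  next
    obtain C where C: "\<And>t. t \<ge> 1 \<Longrightarrow> t powr (- Re s) \<le> C * exp (Re z / 2 * t)"
      using powr_le_exp[of "Re z / 2" "- Re s"] z by auto
    have "((\<lambda>t. C * exp (- (Re z / 2) * t)) \<longlongrightarrow> 0) at_top"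
      using z by real_asymp
    moreover have "\<forall>\<^sub>F t in at_top. norm (- ?f s t) \<le> C * exp (- (Re z / 2) * t)"
      using eventually_ge_at_top[of 1]
    proof eventually_elim
      case (elim t)
      have "exp (- Re z * t) * t powr (- Re s) \<le> exp (- Re z * t) * (C * exp (Re z / 2 * t))"
        using C elim by (intro mult_left_mono) auto
      also have "\<dots> = C * exp (- (Re z / 2) * t)"
        by (simp add: exp_add[symmetric] mult.left_commute)
      finally show ?case
        using elim norm_exp_powr[of t z s] by simp
    qed
    ultimately show "((\<lambda>t. - ?f s t) \<longlongrightarrow> 0) at_top"
      by (rule Lim_null_comparison[rotated])
  qed
  moreover have "((\<lambda>t. z * ?f s t + s * ?f (s + 1) t) has_integral (z * expint_J s z + s * expint_J (s + 1) z)) {1..}"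
    unfolding expint_J_def
    by (intro has_integral_add has_integral_mult_right integrable_integral
        set_lebesgue_integral_eq_integral(1) expint_absolutely_integrable z)
  ultimately have "0 - (- ?f s 1) = z * expint_J s z + s * expint_J (s + 1) z"
    by (rule has_integral_unique)
  then show ?thesis by (simp add: algebra_simps)
qed

text \<open>
  The function \<open>(1 - exp (- u)) / u\<close> has a removable singularity at \<open>0\<close>, hence an entire
  primitive. This splits the primitive \<open>Ln u - Ein u\<close> of \<open>exp (- u) / u\<close> into an entire part
  and a logarithm, so that the boundary behaviour of \<open>E\<^sub>1\<close> on the negative axis is that of \<open>Ln\<close>.
\<close>

lemma ex_Ein: "\<exists>P. P holomorphic_on UNIV \<and>
    (\<forall>u. u \<noteq> 0 \<longrightarrow> (P has_field_derivative (1 - exp (- u)) / u) (at u))"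
proof -
  define f where "f = (\<lambda>u::complex. if u = 0 then deriv (\<lambda>u. - exp (- u)) 0
      else (- exp (- u) - (- exp (- 0))) / (u - 0))"
  have "f holomorphic_on UNIV"
    unfolding f_def by (rule pole_lemma) (auto intro!: holomorphic_intros)
  then obtain P where P: "\<And>u. (P has_field_derivative f u) (at u)"
    using holomorphic_convex_primitive'[of UNIV f] by auto
  have "(P has_field_derivative (1 - exp (- u)) / u) (at u)" if "u \<noteq> 0" for u
    using P[of u] that by (simp add: f_def)
  moreover have "P holomorphic_on UNIV"
    using P by (auto simp: holomorphic_on_open)
  ultimately show ?thesis by blast
qed

text \<open>
  The entire exponential integral, fixed only up to an additive constant, which cancels in every
  use below.
\<close>

definition Ein :: "complex \<Rightarrow> complex" where
  "Ein = (SOME P. P holomorphic_on UNIV \<and>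
    (\<forall>u. u \<noteq> 0 \<longrightarrow> (P has_field_derivative (1 - exp (- u)) / u) (at u)))"

lemma Ein_holomorphic: "Ein holomorphic_on UNIV"
  and Ein_deriv: "u \<noteq> 0 \<Longrightarrow> (Ein has_field_derivative (1 - exp (- u)) / u) (at u)"
  using someI_ex[OF ex_Ein] unfolding Ein_def[symmetric] by auto

lemma Ln_Ein_deriv:
  assumes "u \<notin> \<real>\<^sub>\<le>\<^sub>0"
  shows "((\<lambda>u. Ln u - Ein u) has_field_derivative exp (- u) / u) (at u)"
proof -
  have "u \<noteq> 0" using assms by auto
  have "((\<lambda>u. Ln u - Ein u) has_field_derivative inverse u - (1 - exp (- u)) / u) (at u)"
    using \<open>u \<noteq> 0\<close> assms by (intro DERIV_diff has_field_derivative_Ln Ein_deriv)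
  also have "inverse u - (1 - exp (- u)) / u = exp (- u) / u"
    by (simp add: diff_divide_distrib inverse_eq_divide)
  finally show ?thesis .
qed

lemma Ln_Ein_tendsto:
  assumes z: "Re z > 0"
  shows "((\<lambda>R. Ln (of_real R * z) - Ein (of_real R * z)) \<longlongrightarrow> expint_J 1 z + (Ln z - Ein z)) at_top"
proof -
  let ?G = "\<lambda>u. Ln u - Ein u"
  let ?f = "\<lambda>t. exp (- z * of_real t) * of_real t powr (- 1)"
  note f = expint_absolutely_integrable[OF z, of 1]
  have "((\<lambda>b. set_lebesgue_integral lebesgue {1..b} ?f) \<longlongrightarrow> set_lebesgue_integral lebesgue {1..} ?f) at_top"
    by (rule tendsto_set_lebesgue_integral_at_top) (use f in auto)
  also have "set_lebesgue_integral lebesgue {1..} ?f = expint_J 1 z"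
    using set_lebesgue_integral_eq_integral(2)[OF f] by (simp add: expint_J_def)
  finally have lim: "((\<lambda>b. set_lebesgue_integral lebesgue {1..b} ?f) \<longlongrightarrow> expint_J 1 z) at_top" .
  have "\<forall>\<^sub>F b in at_top. set_lebesgue_integral lebesgue {1..b} ?f = ?G (of_real b * z) - ?G (of_real 1 * z)"
    using eventually_ge_at_top[of 1]
  proof eventually_elim
    case (elim b)
    have "?f absolutely_integrable_on {1..b}"
      by (rule set_integrable_subset[OF f]) auto
    then have "set_lebesgue_integral lebesgue {1..b} ?f = integral {1..b} ?f"
      by (rule set_lebesgue_integral_eq_integral)
    also have "(?f has_integral (?G (of_real b * z) - ?G (of_real 1 * z))) {1..b}"
    proof (rule fundamental_theorem_of_calculus[OF elim])
      fix t :: real assume t: "t \<in> {1..b}"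
      have "of_real t * z \<notin> \<real>\<^sub>\<le>\<^sub>0"
        using t z by (auto simp: complex_nonpos_Reals_iff mult_le_0_iff)
      then have "((\<lambda>w. ?G (w * z)) has_field_derivative exp (- (of_real t * z)) / (of_real t * z) * (1 * z)) (at (of_real t))"
        by (intro DERIV_chain2[OF Ln_Ein_deriv] DERIV_cmult_right DERIV_ident)
      also have "exp (- (of_real t * z)) / (of_real t * z) * (1 * z) = ?f t"
        using t z by (auto simp: powr_minus field_simps)
      finally show "((\<lambda>t. ?G (of_real t * z)) has_vector_derivative ?f t) (at t within {1..b})"
        by (rule has_vector_derivative_at_within[OF has_vector_derivative_real_field])
    qed
    then have "integral {1..b} ?f = ?G (of_real b * z) - ?G (of_real 1 * z)" by (rule integral_unique)
    finally show ?case .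
  qed
  with lim have "((\<lambda>b. ?G (of_real b * z) - ?G (of_real 1 * z)) \<longlongrightarrow> expint_J 1 z) at_top"
    by (subst (asm) tendsto_cong) auto
  from tendsto_add[OF this tendsto_const[of "?G z"]] show ?thesis by simp
qed

text \<open>
  The limit of \<open>Ln u - Ein u\<close> along a ray in the right half-plane does not depend on the ray,
  because the difference between two rays is an integral of \<open>exp (- u) / u\<close> over a segment far to
  the right.
\<close>

lemma Ln_Ein_limit_unique:
  assumes z: "Re z > 0"
  shows "expint_J 1 z + (Ln z - Ein z) = expint_J 1 1 - Ein 1"
proof -
  let ?G = "\<lambda>u. Ln u - Ein u"
  \<comment> \<open>both rays, scaled by \<open>R\<close>, lie in the half-plane \<open>Re u \<ge> \<delta> R\<close>\<close>
  define \<delta> where "\<delta> = min 1 (Re z)"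
  have \<delta>: "\<delta> > 0" using z by (simp add: \<delta>_def)
  have "((\<lambda>R. ?G (of_real R * z) - ?G (of_real R * 1)) \<longlongrightarrow> 0) at_top"
  proof (rule Lim_null_comparison)
    show "((\<lambda>R. exp (- \<delta> * R) / \<delta> * norm (z - 1)) \<longlongrightarrow> 0) at_top"
      using \<delta> by real_asymp
    show "\<forall>\<^sub>F R in at_top. norm (?G (of_real R * z) - ?G (of_real R * 1)) \<le> exp (- \<delta> * R) / \<delta> * norm (z - 1)"
      using eventually_gt_at_top[of 0]
    proof eventually_elim
      case (elim R)
      have "norm (?G (of_real R * z) - ?G (of_real R * 1)) \<le>
          exp (- \<delta> * R) / (\<delta> * R) * norm (of_real R * z - of_real R * 1)"
      proof (rule field_differentiable_bound[of "{u. Re u \<ge> \<delta> * R}"])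
        show "convex {u. \<delta> * R \<le> Re u}" by (rule convex_halfspace_Re_ge)
        fix u assume u: "u \<in> {u. \<delta> * R \<le> Re u}"
        have pos: "\<delta> * R > 0" using \<delta> elim by simp
        with u have "u \<notin> \<real>\<^sub>\<le>\<^sub>0" by (auto simp: complex_nonpos_Reals_iff)
        then show "(?G has_field_derivative exp (- u) / u) (at u within {u. \<delta> * R \<le> Re u})"
          by (rule has_field_derivative_at_within[OF Ln_Ein_deriv])
        have "\<delta> * R \<le> norm u" using u complex_Re_le_cmod[of u] by auto
        then show "norm (exp (- u) / u) \<le> exp (- \<delta> * R) / (\<delta> * R)"
          using u pos by (auto simp: norm_divide intro!: frac_le)
      qed (use elim in \<open>auto simp: \<delta>_def mult.commute\<close>)
      also have "norm (of_real R * z - of_real R * 1) = R * norm (z - 1)"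
        using elim by (simp only: right_diff_distrib[symmetric] norm_mult norm_of_real abs_of_pos)
      finally show ?case using elim by simp
    qed
  qed
  moreover have "((\<lambda>R. ?G (of_real R * z) - ?G (of_real R * 1)) \<longlongrightarrow>
      (expint_J 1 z + ?G z) - (expint_J 1 1 + ?G 1)) at_top"
    by (intro tendsto_diff Ln_Ein_tendsto z) simp
  ultimately have "0 = (expint_J 1 z + ?G z) - (expint_J 1 1 + ?G 1)"
    by (intro tendsto_unique[OF trivial_limit_at_top_linorder])
  then show ?thesis by simp
qed

text \<open>
  The exponential integral \<open>E\<^sub>1\<close>. The additive constant is the limit of \<open>Ln u - Ein u\<close>, so that
  the function vanishes at infinity in the right half-plane.
\<close>

definition expint1 :: "complex \<Rightarrow> complex" where
  "expint1 z = (expint_J 1 1 - Ein 1) + Ein z - Ln z"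

lemma expint1_eq_expint_J: "Re z > 0 \<Longrightarrow> expint1 z = expint_J 1 z"
  using Ln_Ein_limit_unique[of z] by (simp add: expint1_def algebra_simps)

lemma expint1_deriv:
  assumes "u \<notin> \<real>\<^sub>\<le>\<^sub>0"
  shows "(expint1 has_field_derivative - exp (- u) / u) (at u)"
proof -
  have "expint1 = (\<lambda>u. (expint_J 1 1 - Ein 1) - (Ln u - Ein u))"
    by (auto simp: expint1_def)
  moreover have "((\<lambda>u. (expint_J 1 1 - Ein 1) - (Ln u - Ein u)) has_field_derivative 0 - exp (- u) / u) (at u)"
    by (intro DERIV_diff DERIV_const Ln_Ein_deriv assms)
  ultimately show ?thesis by simp
qed

text \<open>
  Decay in vertical direction, also to the left of the imaginary axis where the integral formula is
  not available. On the line \<open>Re u = 1\<close> the bound follows from the recurrence; from there one moves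
  along a horizontal segment, on which \<open>exp (- u) / u\<close> is \<open>O(1 / \<bar>y\<bar>)\<close>.
\<close>

lemma expint1_bound:
  fixes a y :: real
  assumes y: "y \<noteq> 0"
  shows "norm (expint1 (Complex a y)) \<le> (1 + exp (\<bar>a\<bar> + 1) * \<bar>a - 1\<bar>) / \<bar>y\<bar>"
proof -
  let ?w = "Complex 1 y"
  have "norm (expint_J 2 ?w) \<le> integral {1..} (\<lambda>t. exp (- 1 * t))"
    unfolding expint_J_def
  proof (rule integral_norm_bound_integral)
    show "(\<lambda>t. exp (- ?w * of_real t) * of_real t powr - 2) integrable_on {1..}"
      by (intro set_lebesgue_integral_eq_integral(1) expint_absolutely_integrable) simp
    show "(\<lambda>t::real. exp (- 1 * t)) integrable_on {1..}"
      by (rule integrable_on_exp_minus_to_infinity) simp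
    fix t :: real assume t: "t \<in> {1..}"
    then have "t powr (- 2) \<le> 1" by (simp add: powr_minus inverse_le_1_iff)
    then show "norm (exp (- ?w * of_real t) * of_real t powr - 2) \<le> exp (- 1 * t)"
      using t by (subst norm_exp_powr) (auto intro: mult_left_le)
  qed
  also have "\<dots> = exp (- 1)"
    using has_integral_exp_minus_to_infinity[of 1 1] by (simp add: integral_unique)
  finally have J2: "norm (expint_J 2 ?w) \<le> exp (- 1)" .
  have "norm (?w * expint1 ?w) = norm (exp (- ?w) - expint_J 2 ?w)"
    using expint_J_rec[of ?w 1] by (simp add: expint1_eq_expint_J)
  also have "\<dots> \<le> exp (- 1) + exp (- 1)"
    using J2 norm_triangle_ineq4[of "exp (- ?w)" "expint_J 2 ?w"] by simp
  also have "\<dots> \<le> 1"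
    using exp_ge_add_one_self[of 1] by (simp add: exp_minus field_simps)
  finally have "norm ?w * norm (expint1 ?w) \<le> 1" by (simp only: norm_mult)
  moreover have "\<bar>y\<bar> * norm (expint1 ?w) \<le> norm ?w * norm (expint1 ?w)"
    using abs_Im_le_cmod[of ?w] by (intro mult_right_mono) auto
  ultimately have E1w: "norm (expint1 ?w) \<le> 1 / \<bar>y\<bar>"
    using y by (simp add: field_simps)
  have "norm (expint1 (Complex a y) - expint1 ?w) \<le> exp (\<bar>a\<bar> + 1) / \<bar>y\<bar> * norm (Complex a y - ?w)"
  proof (rule field_differentiable_bound)
    let ?S = "{u. Im u = y \<and> \<bar>Re u\<bar> \<le> \<bar>a\<bar> + 1}"
    have "?S = {u. Im u = y} \<inter> {u. Re u \<le> \<bar>a\<bar> + 1} \<inter> {u. Re u \<ge> - \<bar>a\<bar> - 1}" by auto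
    moreover have "convex {u. Im u = y}"
      by (auto simp: convex_def distrib_right[symmetric])
    ultimately show "convex ?S"
      by (simp add: convex_Int convex_halfspace_Re_le convex_halfspace_Re_ge)
    fix u assume u: "u \<in> ?S"
    then show "(expint1 has_field_derivative - exp (- u) / u) (at u within ?S)"
      using y by (intro has_field_derivative_at_within[OF expint1_deriv]) (auto simp: complex_nonpos_Reals_iff)
    show "norm (- exp (- u) / u) \<le> exp (\<bar>a\<bar> + 1) / \<bar>y\<bar>"
      using u y abs_Im_le_cmod[of u] by (auto simp: norm_divide intro!: frac_le)
  qed auto
  moreover have "norm (Complex a y - ?w) = \<bar>a - 1\<bar>"
    by (simp add: cmod_def)
  moreover have "norm (expint1 (Complex a y)) \<le> norm (expint1 ?w) + norm (expint1 (Complex a y) - expint1 ?w)"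
    by (rule norm_triangle_sub)
  ultimately show ?thesis
    using E1w by (simp add: add_divide_distrib)
qed

text \<open>
  The defining conditions of \<^const>\<open>exp_integral_E\<close>. They are verified for \<open>s = 1\<close> by
  \<open>expint1\<close>, and carried to every integer by the recurrence in both directions.
\<close>

definition is_expint :: "complex \<Rightarrow> (complex \<Rightarrow> complex) \<Rightarrow> bool" where
  "is_expint s g \<longleftrightarrow>
     g holomorphic_on (- \<real>\<^sub>\<le>\<^sub>0) \<and>
     (\<forall>z. Re z > 0 \<longrightarrow> g z = integral {1..} (\<lambda>t. exp (- z * of_real t) * of_real t powr (- s))) \<and>
     (\<forall>x::real. x < 0 \<longrightarrow>
        ((\<lambda>\<epsilon>. g (of_real x + \<i> * of_real \<epsilon>)) \<longlongrightarrow> g (of_real x)) (at_right 0))"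

lemma is_expint_alt:
  "is_expint s g \<longleftrightarrow> g holomorphic_on (- \<real>\<^sub>\<le>\<^sub>0) \<and> (\<forall>z. Re z > 0 \<longrightarrow> g z = expint_J s z) \<and>
     (\<forall>x::real. x < 0 \<longrightarrow>
        ((\<lambda>\<epsilon>. g (of_real x + \<i> * of_real \<epsilon>)) \<longlongrightarrow> g (of_real x)) (at_right 0))"
  by (simp add: is_expint_def expint_J_def)

text \<open>
  On the upper half-plane and the negative axis the principal branch is \<open>Ln (- z) + i \<pi>\<close>, which
  is continuous across the negative axis.
\<close>

lemma Ln_tendsto_upper:
  fixes x :: real
  assumes "x < 0"
  shows "((\<lambda>\<epsilon>. Ln (of_real x + \<i> * of_real \<epsilon>)) \<longlongrightarrow> Ln (of_real x)) (at_right 0)"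
proof -
  have Ln_up: "Ln z = Ln (- z) + \<i> * of_real pi" if "Im z > 0 \<or> Im z = 0 \<and> Re z < 0" for z
  proof -
    have "z \<noteq> 0" using that by auto
    then show ?thesis using that by (auto simp: Ln_minus)
  qed
  have "((\<lambda>\<epsilon>. Ln (- (of_real x + \<i> * of_real \<epsilon>)) + \<i> * of_real pi) \<longlongrightarrow>
      Ln (- (of_real x + \<i> * of_real 0)) + \<i> * of_real pi) (at_right 0)"
    by (intro tendsto_intros) (use assms in \<open>auto simp: complex_nonpos_Reals_iff\<close>)
  moreover have "\<forall>\<^sub>F \<epsilon> in at_right 0. Ln (of_real x + \<i> * of_real \<epsilon>) =
      Ln (- (of_real x + \<i> * of_real \<epsilon>)) + \<i> * of_real pi"
    using eventually_at_right_less[of "0::real"] by eventually_elim (rule Ln_up, auto)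
  moreover have "Ln (of_real x) = Ln (- (of_real x + \<i> * of_real 0)) + \<i> * of_real pi"
    using Ln_up[of "of_real x"] assms by simp
  ultimately show ?thesis by (simp add: tendsto_cong)
qed

lemma is_expint_1: "is_expint 1 expint1"
  unfolding is_expint_alt
proof (intro conjI allI impI)
  show "expint1 holomorphic_on - \<real>\<^sub>\<le>\<^sub>0"
    using expint1_deriv by (subst holomorphic_on_open) (auto simp: open_Compl)
  fix x :: real assume "x < 0"
  have "((\<lambda>\<epsilon>. Ein (of_real x + \<i> * of_real \<epsilon>)) \<longlongrightarrow> Ein (of_real x + \<i> * of_real 0)) (at_right 0)"
  proof (rule isCont_tendsto_compose[of _ Ein])
    show "((\<lambda>\<epsilon>. of_real x + \<i> * of_real \<epsilon>) \<longlongrightarrow> of_real x + \<i> * of_real 0) (at_right 0)"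
      by (intro tendsto_intros)
    show "isCont Ein (of_real x + \<i> * of_real 0)"
      using holomorphic_on_imp_continuous_on[OF Ein_holomorphic]
      by (auto intro: continuous_on_interior)
  qed
  then show "((\<lambda>\<epsilon>. expint1 (of_real x + \<i> * of_real \<epsilon>)) \<longlongrightarrow> expint1 (of_real x)) (at_right 0)"
    unfolding expint1_def by (intro tendsto_intros Ln_tendsto_upper \<open>x < 0\<close>) simp
qed (rule expint1_eq_expint_J)

lemma is_expint_minus1:
  assumes "is_expint (s + 1) g"
  shows "is_expint s (\<lambda>z. (exp (- z) - s * g z) / z)"
  unfolding is_expint_alt
proof (intro conjI allI impI)
  show "(\<lambda>z. (exp (- z) - s * g z) / z) holomorphic_on - \<real>\<^sub>\<le>\<^sub>0"
    using assms by (auto simp: is_expint_def intro!: holomorphic_intros)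
  show "(exp (- z) - s * g z) / z = expint_J s z" if z: "Re z > 0" for z
  proof -
    have "z \<noteq> 0" using z by auto
    moreover have "g z = expint_J (s + 1) z" using assms z by (simp add: is_expint_alt)
    ultimately show ?thesis using expint_J_rec[OF z, of s] by (simp add: field_simps)
  qed
  fix x :: real assume x: "x < 0"
  have "((\<lambda>\<epsilon>. g (of_real x + \<i> * of_real \<epsilon>)) \<longlongrightarrow> g (of_real x)) (at_right 0)"
    using assms x by (simp add: is_expint_def)
  then have "((\<lambda>\<epsilon>. (exp (- (of_real x + \<i> * of_real \<epsilon>)) - s * g (of_real x + \<i> * of_real \<epsilon>)) / (of_real x + \<i> * of_real \<epsilon>))
     \<longlongrightarrow> (exp (- (of_real x + \<i> * of_real 0)) - s * g (of_real x)) / (of_real x + \<i> * of_real 0)) (at_right 0)"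
    by (intro tendsto_intros) (use x in auto)
  then show "((\<lambda>\<epsilon>. (exp (- (of_real x + \<i> * of_real \<epsilon>)) - s * g (of_real x + \<i> * of_real \<epsilon>)) / (of_real x + \<i> * of_real \<epsilon>))
     \<longlongrightarrow> (exp (- of_real x) - s * g (of_real x)) / of_real x) (at_right 0)" by simp
qed

lemma is_expint_plus1:
  assumes "is_expint s g" "s \<noteq> 0"
  shows "is_expint (s + 1) (\<lambda>z. (exp (- z) - z * g z) / s)"
  unfolding is_expint_alt
proof (intro conjI allI impI)
  show "(\<lambda>z. (exp (- z) - z * g z) / s) holomorphic_on - \<real>\<^sub>\<le>\<^sub>0"
    using assms by (auto simp: is_expint_def intro!: holomorphic_intros)
  show "(exp (- z) - z * g z) / s = expint_J (s + 1) z" if z: "Re z > 0" for z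
  proof -
    have "g z = expint_J s z" using assms z by (simp add: is_expint_alt)
    then show ?thesis using expint_J_rec[OF z, of s] assms(2) by (simp add: field_simps)
  qed
  fix x :: real assume x: "x < 0"
  have "((\<lambda>\<epsilon>. g (of_real x + \<i> * of_real \<epsilon>)) \<longlongrightarrow> g (of_real x)) (at_right 0)"
    using assms x by (simp add: is_expint_def)
  then have "((\<lambda>\<epsilon>. (exp (- (of_real x + \<i> * of_real \<epsilon>)) - (of_real x + \<i> * of_real \<epsilon>) * g (of_real x + \<i> * of_real \<epsilon>)) / s)
     \<longlongrightarrow> (exp (- (of_real x + \<i> * of_real 0)) - (of_real x + \<i> * of_real 0) * g (of_real x)) / s) (at_right 0)"
    by (intro tendsto_intros) (use assms in auto)
  then show "((\<lambda>\<epsilon>. (exp (- (of_real x + \<i> * of_real \<epsilon>)) - (of_real x + \<i> * of_real \<epsilon>) * g (of_real x + \<i> * of_real \<epsilon>)) / s)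
     \<longlongrightarrow> (exp (- of_real x) - of_real x * g (of_real x)) / s) (at_right 0)" by simp
qed

lemma ex_is_expint: "\<exists>g. is_expint (of_int s) g"
proof (induction s rule: int_induct[where k = 1])
  case base
  show ?case using is_expint_1 by auto
next
  case (step1 i)
  then obtain g where "is_expint (of_int i) g" by blast
  then have "is_expint (of_int i + 1) (\<lambda>z. (exp (- z) - z * g z) / of_int i)"
    by (rule is_expint_plus1) (use step1 in auto)
  then show ?case by auto
next
  case (step2 i)
  then obtain g where "is_expint (of_int (i - 1) + 1) g" by auto
  then show ?case by (blast dest: is_expint_minus1)
qed

lemma exp_integral_E_is_expint: "is_expint (of_int s) (exp_integral_E (of_int s))"
  using someI_ex[OF ex_is_expint] unfolding exp_integral_E_def is_expint_def .

text \<open>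
  The right half-plane determines the function on the slit plane by the identity theorem, and the
  slit plane determines the boundary values on the negative axis.
\<close>

lemma is_expint_unique:
  fixes x :: real
  assumes g: "is_expint s g" and h: "is_expint s h" and x: "x \<noteq> 0"
  shows "g (of_real x) = h (of_real x)"
proof (cases "x > 0")
  case True
  then show ?thesis using g h by (simp add: is_expint_def)
next
  case False
  then have x: "x < 0" using x by simp
  have eq: "g z = h z" if "z \<notin> \<real>\<^sub>\<le>\<^sub>0" for z
  proof (rule analytic_continuation_open[of "{z. Re z > 0}" "- \<real>\<^sub>\<le>\<^sub>0" g h])
    show "open {z. Re z > 0}" by (rule open_halfspace_Re_gt)
    show "{z. Re z > 0} \<noteq> {}" by (auto intro!: exI[of _ 1])
    show "connected (- \<real>\<^sub>\<le>\<^sub>0 :: complex set)"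
    proof -
      have "(\<real>\<^sub>\<le>\<^sub>0 :: complex set) = complex_of_real ` {..0}"
        by (auto simp: nonpos_Reals_def)
      show ?thesis
        unfolding \<open>_ = complex_of_real ` {..0}\<close>
        by (intro starlike_imp_connected starlike_slotted_complex_plane_left)
    qed
    show "{z. Re z > 0} \<subseteq> - \<real>\<^sub>\<le>\<^sub>0" by (auto simp: complex_nonpos_Reals_iff)
  qed (use g h that in \<open>auto simp: is_expint_def\<close>)
  have "((\<lambda>\<epsilon>. g (of_real x + \<i> * of_real \<epsilon>)) \<longlongrightarrow> g (of_real x)) (at_right 0)"
    using g x by (simp add: is_expint_def)
  moreover have "((\<lambda>\<epsilon>. h (of_real x + \<i> * of_real \<epsilon>)) \<longlongrightarrow> h (of_real x)) (at_right 0)"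
    using h x by (simp add: is_expint_def)
  moreover have "\<forall>\<^sub>F \<epsilon> in at_right 0. g (of_real x + \<i> * of_real \<epsilon>) = h (of_real x + \<i> * of_real \<epsilon>)"
    using eventually_at_right_less[of "0::real"]
    by eventually_elim (auto intro!: eq simp: complex_nonpos_Reals_iff)
  ultimately have "((\<lambda>\<epsilon>. h (of_real x + \<i> * of_real \<epsilon>)) \<longlongrightarrow> g (of_real x)) (at_right 0)"
    by (simp add: tendsto_cong)
  with \<open>((\<lambda>\<epsilon>. h (of_real x + \<i> * of_real \<epsilon>)) \<longlongrightarrow> h (of_real x)) (at_right 0)\<close> show ?thesis
    by (metis tendsto_unique trivial_limit_at_right_real)
qed

lemma exp_integral_E_1:
  fixes x :: real
  assumes "x \<noteq> 0"
  shows "exp_integral_E 1 (of_real x) = expint1 (of_real x)"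
  using is_expint_unique[OF exp_integral_E_is_expint[of 1, simplified] is_expint_1 assms] .

lemma exp_integral_E_rec:
  fixes x :: real
  assumes "x \<noteq> 0"
  shows "of_real x * exp_integral_E (of_int s) (of_real x) =
    exp (- of_real x) - of_int s * exp_integral_E (of_int s + 1) (of_real x)"
proof -
  have "is_expint (of_int s + 1) (exp_integral_E (of_int s + 1))"
    using exp_integral_E_is_expint[of "s + 1"] by simp
  from is_expint_unique[OF exp_integral_E_is_expint is_expint_minus1[OF this] assms]
  show ?thesis using assms by (simp add: field_simps)
qed

section \<open>Integrals over the unit segment\<close>

lemma zeta_star_deriv:
  assumes z: "Im z > 0" and a: "a \<noteq> 0"
  shows "(zeta_star a has_field_derivative - a * zeta_star (a + 1) z) (at z)"
proof (cases "a = 1")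
  case True
  have "(neg_digamma has_field_derivative - a * zeta_star (a + 1) z) (at z)"
    using neg_digamma_deriv[OF z] True z by (simp add: zeta_star_eq)
  then show ?thesis
    by (rule has_field_derivative_transform_within_open[OF _ open_uhp])
       (use z True in \<open>auto simp: zeta_star_eq\<close>)
next
  case False
  have "((\<lambda>z. zeta_reg a z / (a - 1)) has_field_derivative (1 - a) * zeta_reg (a + 1) z / (a - 1)) (at z)"
    by (intro DERIV_cdivide zeta_reg_deriv z)
  also have "(1 - a) * zeta_reg (a + 1) z / (a - 1) = - a * zeta_star (a + 1) z"
    using a False z by (simp add: zeta_star_eq divide_eq_eq) (simp add: algebra_simps)
  finally show ?thesis
    by (rule has_field_derivative_transform_within_open[OF _ open_uhp])
       (use z False in \<open>auto simp: zeta_star_eq\<close>)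
qed

text \<open>
  The rule \<open>d/dz \<zeta>(s, z) = - s \<zeta>(s + 1, z)\<close> has to be read as a limit at \<open>s = 0\<close>, where the zero
  of the factor \<open>s\<close> meets the pole of \<open>\<zeta>(s + 1, z)\<close>.
\<close>

lemma zeta_star_0_deriv:
  assumes z: "Im z > 0"
  shows "(zeta_star 0 has_field_derivative - 1) (at z)"
proof -
  have "((\<lambda>z. zeta_reg 0 z / (0 - 1)) has_field_derivative (1 - 0) * zeta_reg (0 + 1) z / (0 - 1)) (at z)"
    by (intro DERIV_cdivide zeta_reg_deriv z)
  then have "((\<lambda>z. zeta_reg 0 z / (0 - 1)) has_field_derivative - 1) (at z)"
    using z by (simp add: zeta_reg_1)
  then show ?thesis
    by (rule has_field_derivative_transform_within_open[OF _ open_uhp])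
       (use z in \<open>auto simp: zeta_star_eq\<close>)
qed

lemma zeta_star_plus1:
  assumes z: "Im z > 0"
  shows "zeta_star a (z + 1) = zeta_star a z - z powr (- a)"
proof (cases "a = 1")
  case True
  then show ?thesis
    using z neg_digamma_plus1[OF z] by (simp add: zeta_star_eq powr_minus inverse_eq_divide)
next
  case False
  then show ?thesis
    using z zeta_reg_plus1[OF z, of a] by (simp add: zeta_star_eq field_simps)
qed

lemma continuous_on_zeta_star: "continuous_on uhp (zeta_star a)"
proof (cases "a = 0")
  case True
  then show ?thesis
    by (auto intro!: continuous_at_imp_continuous_on DERIV_isCont[OF zeta_star_0_deriv])
next
  case False
  then show ?thesis
    by (auto intro!: continuous_at_imp_continuous_on DERIV_isCont[OF zeta_star_deriv])
qed

abbreviation unit_seg :: "real \<Rightarrow> complex" where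
  "unit_seg \<equiv> linepath \<i> (\<i> + 1)"

lemma unit_seg_mem: "z \<in> closed_segment \<i> (\<i> + 1) \<longleftrightarrow> Im z = 1 \<and> 0 \<le> Re z \<and> Re z \<le> 1"
proof
  assume "z \<in> closed_segment \<i> (\<i> + 1)"
  then show "Im z = 1 \<and> 0 \<le> Re z \<and> Re z \<le> 1"
    by (auto simp: closed_segment_def)
next
  assume *: "Im z = 1 \<and> 0 \<le> Re z \<and> Re z \<le> 1"
  then show "z \<in> closed_segment \<i> (\<i> + 1)"
    unfolding closed_segment_def by (auto simp: complex_eq_iff intro!: exI[of _ "Re z"])
qed

lemma unit_seg_subset_uhp: "closed_segment \<i> (\<i> + 1) \<subseteq> uhp"
  by (auto simp: unit_seg_mem)

lemma unit_seg_integrable: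
  assumes "continuous_on uhp g"
  shows "g contour_integrable_on unit_seg"
  by (intro contour_integrable_continuous_linepath continuous_on_subset[OF assms unit_seg_subset_uhp])

lemma unit_seg_primitive:
  assumes "\<And>z. Im z > 0 \<Longrightarrow> (F has_field_derivative F' z) (at z)"
  shows "contour_integral unit_seg F' = F (\<i> + 1) - F \<i>"
proof -
  have "(F' has_contour_integral (F (pathfinish unit_seg) - F (pathstart unit_seg))) unit_seg"
    by (rule contour_integral_primitive[of uhp])
       (use assms unit_seg_subset_uhp in \<open>auto intro: has_field_derivative_at_within\<close>)
  then show ?thesis by (simp add: contour_integral_unique)
qed

text \<open>
  The character \<open>exp (2 \<pi> i n z)\<close>; with \<open>x = 2 \<pi> n\<close> it is \<open>exp (i x z)\<close>.
\<close>

definition eint :: "int \<Rightarrow> complex \<Rightarrow> complex" where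
  "eint n z = exp (\<i> * of_real (2 * pi * of_int n) * z)"

lemma eint_add_nat: "eint n (z + of_nat j) = eint n z"
proof -
  have "exp (\<i> * of_real (2 * pi * of_int n) * of_nat j) = exp (2 * of_real pi * \<i> * of_int (n * int j))"
    by (simp add: mult_ac)
  also have "\<dots> = 1"
    by (auto simp: exp_eq_1 intro!: exI[of _ "n * int j"])
  finally show ?thesis
    by (simp add: eint_def distrib_left exp_add)
qed

lemma eint_plus1: "eint n (z + 1) = eint n z"
  using eint_add_nat[of n z 1] by simp

lemma eint_deriv: "(eint n has_field_derivative \<i> * of_real (2 * pi * of_int n) * eint n z) (at z)"
  unfolding eint_def[abs_def] by (auto intro!: derivative_eq_intros)

lemma continuous_on_eint: "continuous_on S (eint n)"
  unfolding eint_def[abs_def] by (intro continuous_intros)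

lemma norm_eint: "norm (eint n z) = exp (- (2 * pi * of_int n) * Im z)"
  by (simp add: eint_def)

lemma eint_i: "eint n \<i> = exp (- of_real (2 * pi * of_int n))"
proof -
  have "\<i> * c * \<i> = - c" for c
    by (simp add: complex_eq_iff)
  then show ?thesis by (simp only: eint_def)
qed

lemma unit_seg_integral_eint: "contour_integral unit_seg (eint n) = (if n = 0 then 1 else 0)"
proof (cases "n = 0")
  case True
  have "contour_integral unit_seg (\<lambda>_. 1) = (\<i> + 1) - \<i>"
    by (rule unit_seg_primitive) (rule DERIV_ident)
  moreover have "eint 0 = (\<lambda>_. 1)" by (simp add: eint_def fun_eq_iff)
  ultimately show ?thesis using True by simp
next
  case False
  define c where "c = \<i> * complex_of_real (2 * pi * of_int n)"
  have c: "c \<noteq> 0" using False by (simp add: c_def)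
  have "((\<lambda>z. eint n z / c) has_field_derivative eint n z) (at z)" for z
    using DERIV_cdivide[OF eint_deriv[of n z], of c] c by (simp add: c_def)
  then have "contour_integral unit_seg (eint n) = eint n (\<i> + 1) / c - eint n \<i> / c"
    by (intro unit_seg_primitive)
  then show ?thesis using False by (simp add: eint_plus1)
qed

text \<open>
  Periodicity of the exponential leaves only the increment of \<open>F\<close> in the boundary term.
\<close>

lemma unit_seg_by_parts:
  assumes F: "\<And>z. Im z > 0 \<Longrightarrow> (F has_field_derivative F' z) (at z)" and F': "continuous_on uhp F'"
  shows "\<i> * of_real (2 * pi * of_int n) * contour_integral unit_seg (\<lambda>z. eint n z * F z) =
    eint n \<i> * (F (\<i> + 1) - F \<i>) - contour_integral unit_seg (\<lambda>z. eint n z * F' z)"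
proof -
  let ?c = "\<i> * of_real (2 * pi * of_int n)"
  have contF: "continuous_on uhp F"
    by (auto intro!: continuous_at_imp_continuous_on DERIV_isCont[OF F])
  have "contour_integral unit_seg (\<lambda>z. ?c * eint n z * F z + F' z * eint n z) =
      eint n (\<i> + 1) * F (\<i> + 1) - eint n \<i> * F \<i>"
    by (intro unit_seg_primitive DERIV_mult eint_deriv F)
  also have "(\<lambda>z. ?c * eint n z * F z + F' z * eint n z) = (\<lambda>z. ?c * (eint n z * F z) + eint n z * F' z)"
    by (simp add: mult_ac)
  also have "contour_integral unit_seg \<dots> = contour_integral unit_seg (\<lambda>z. ?c * (eint n z * F z)) +
      contour_integral unit_seg (\<lambda>z. eint n z * F' z)"
    by (intro contour_integral_add unit_seg_integrable continuous_intros continuous_on_eint contF F')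
  also have "contour_integral unit_seg (\<lambda>z. ?c * (eint n z * F z)) =
      ?c * contour_integral unit_seg (\<lambda>z. eint n z * F z)"
    by (intro contour_integral_lmul unit_seg_integrable continuous_intros continuous_on_eint contF)
  finally show ?thesis by (simp add: eint_plus1 algebra_simps)
qed

section \<open>Fourier coefficients of the Hurwitz zeta function\<close>

definition zeta_fourier :: "int \<Rightarrow> complex \<Rightarrow> complex" where
  "zeta_fourier n a = contour_integral unit_seg (\<lambda>z. eint n z * zeta_star a z)"

text \<open>
  At \<open>a = 0\<close> the derivative of \<open>zeta_star\<close> is the constant \<open>- 1\<close>, whose integral against the
  exponential vanishes. So the same formula holds there.
\<close>

lemma zeta_fourier_rec:
  assumes n: "n \<noteq> 0"
  shows "\<i> * of_real (2 * pi * of_int n) * zeta_fourier n a =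
    a * zeta_fourier n (a + 1) - exp (- of_real (2 * pi * of_int n)) * \<i> powr (- a)"
proof -
  have diff: "zeta_star a (\<i> + 1) - zeta_star a \<i> = - (\<i> powr (- a))"
    by (subst zeta_star_plus1) auto
  show ?thesis
  proof (cases "a = 0")
    case True
    have "\<i> * of_real (2 * pi * of_int n) * zeta_fourier n 0 =
        eint n \<i> * (zeta_star 0 (\<i> + 1) - zeta_star 0 \<i>) - contour_integral unit_seg (\<lambda>z. eint n z * (- 1))"
      unfolding zeta_fourier_def by (intro unit_seg_by_parts zeta_star_0_deriv) auto
    also have "contour_integral unit_seg (\<lambda>z. eint n z * (- 1)) = 0"
      using n contour_integral_rmul[OF unit_seg_integrable[OF continuous_on_eint], of n "- 1"]
      by (simp only: unit_seg_integral_eint) simp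
    finally show ?thesis
      using diff True by (simp add: eint_i)
  next
    case False
    have "\<i> * of_real (2 * pi * of_int n) * zeta_fourier n a =
        eint n \<i> * (zeta_star a (\<i> + 1) - zeta_star a \<i>) -
        contour_integral unit_seg (\<lambda>z. eint n z * (- a * zeta_star (a + 1) z))"
      unfolding zeta_fourier_def
      by (intro unit_seg_by_parts zeta_star_deriv False continuous_intros continuous_on_zeta_star)
    also have "(\<lambda>z. eint n z * (- a * zeta_star (a + 1) z)) = (\<lambda>z. - a * (eint n z * zeta_star (a + 1) z))"
      by (simp add: mult_ac)
    also have "contour_integral unit_seg \<dots> = - a * zeta_fourier n (a + 1)"
      unfolding zeta_fourier_def
      by (intro contour_integral_lmul unit_seg_integrable continuous_intros continuous_on_eint continuous_on_zeta_star)
    finally show ?thesis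
      using diff by (simp add: eint_i)
  qed
qed

lemma zeta_fourier_2_sums:
  "(\<lambda>j. contour_integral unit_seg (\<lambda>z. eint n z / (z + of_nat j) ^ 2)) sums zeta_fourier n 2"
proof -
  let ?f = "\<lambda>j z. eint n z / (z + of_nat j) ^ 2"
  have nz: "z + of_nat j \<noteq> 0" if "Im z > 0" for z j
    using that by (auto simp: complex_eq_iff)
  have cont: "continuous_on uhp (?f j)" for j
    by (intro continuous_intros continuous_on_eint) (use nz in auto)
  have int: "?f j contour_integrable_on unit_seg" for j
    by (intro unit_seg_integrable cont)
  have "uniform_limit (path_image unit_seg) (\<lambda>N z. \<Sum>j<N. ?f j z) (\<lambda>z. \<Sum>j. ?f j z) sequentially"
  proof (rule Weierstrass_m_test_ev)
    show "summable (\<lambda>j. exp (- (2 * pi * of_int n)) * (1 / real j ^ 2))"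
      by (intro summable_mult) (use inverse_power_summable[of 2, where ?'a = real] in \<open>simp add: inverse_eq_divide\<close>)
    show "\<forall>\<^sub>F j in sequentially. \<forall>z\<in>path_image unit_seg. norm (?f j z) \<le> exp (- (2 * pi * of_int n)) * (1 / real j ^ 2)"
      using eventually_gt_at_top[of 0]
    proof (eventually_elim, intro ballI)
      fix j :: nat and z assume j: "j > 0" and "z \<in> path_image unit_seg"
      then have z: "Im z = 1" "Re z \<ge> 0" by (auto simp: unit_seg_mem)
      have "real j \<le> \<bar>Re (z + of_nat j)\<bar>" using z by simp
      also have "\<dots> \<le> norm (z + of_nat j)" by (rule abs_Re_le_cmod)
      finally have "real j ^ 2 \<le> norm (z + of_nat j) ^ 2" by (intro power_mono) auto
      then show "norm (?f j z) \<le> exp (- (2 * pi * of_int n)) * (1 / real j ^ 2)"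
        using j z by (auto simp: norm_divide norm_power norm_eint intro!: frac_le)
    qed
  qed
  then have "(\<lambda>N. contour_integral unit_seg (\<lambda>z. \<Sum>j<N. ?f j z)) \<longlonglongrightarrow> contour_integral unit_seg (\<lambda>z. \<Sum>j. ?f j z)"
    by (rule contour_integral_uniform_limit(2)[where B = 1, rotated])
       (auto intro!: always_eventually contour_integrable_sum int)
  moreover have "contour_integral unit_seg (\<lambda>z. \<Sum>j. ?f j z) = zeta_fourier n 2"
    unfolding zeta_fourier_def
  proof (rule contour_integral_cong[OF refl])
    fix z assume "z \<in> path_image unit_seg"
    then have z: "Im z > 0" by (auto simp: unit_seg_mem)
    have p: "(z + of_nat j) powr (- 2) = 1 / (z + of_nat j) ^ 2" for j
      using nz[OF z] by (simp add: powr_minus inverse_eq_divide)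
    have "summable (\<lambda>j. 1 / (z + of_nat j) ^ 2)"
      using hurwitz_summable[of 2 z] by (simp only: p) simp
    then have "(\<Sum>j. eint n z * (1 / (z + of_nat j) ^ 2)) = eint n z * (\<Sum>j. 1 / (z + of_nat j) ^ 2)"
      by (rule suminf_mult)
    also have "(\<Sum>j. 1 / (z + of_nat j) ^ 2) = zeta_star 2 z"
      using z zeta_reg_eq_zeta_reg_series[of 2 z] by (simp add: zeta_star_eq zeta_reg_series_def p)
    finally show "(\<Sum>j. ?f j z) = eint n z * zeta_star 2 z" by simp
  qed
  moreover have "contour_integral unit_seg (\<lambda>z. \<Sum>j<N. ?f j z) = (\<Sum>j<N. contour_integral unit_seg (?f j))" for N
    by (rule contour_integral_sum) (auto intro: int)
  ultimately show ?thesis by (simp add: sums_def)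
qed

text \<open>
  The terms of \<open>zeta_fourier_2_sums\<close> are the increments of a primitive \<open>T\<close> of \<open>exp (i x z) / z\<^sup>2\<close>
  along the horizontal ray from \<open>\<i>\<close>, so the sum is \<open>T(\<i> + \<infinity>) - T(\<i>)\<close>. In \<open>T\<close> the logarithm
  of \<open>- i x z\<close> is split as \<open>Ln z + Ln (- i x)\<close>: this is holomorphic on the whole upper half-plane,
  whereas \<open>- i x z\<close> starts on the cut at \<open>z = \<i>\<close> when \<open>x < 0\<close>. For \<open>Re z \<ge> 0\<close> both forms agree
  and yield the boundary value of \<open>E\<^sub>1\<close> from above.
\<close>

lemma zeta_fourier_2:
  fixes n :: int
  defines "x \<equiv> 2 * pi * real_of_int n"
  assumes n: "n \<noteq> 0"
  shows "zeta_fourier n 2 = \<i> * of_real x * expint1 (of_real x) - \<i> * exp (- of_real x)"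
proof -
  have x: "x \<noteq> 0" using n by (simp add: x_def)
  let ?ix = "\<i> * complex_of_real x"
  define K where "K = expint_J 1 1 - Ein 1"
  \<comment> \<open>a primitive of \<open>exp (i x z) / z\<^sup>2\<close>: the derivative of the second summand is \<open>i x exp (i x z) / z\<close>\<close>
  define T where "T z = - eint n z / z + ?ix * (Ln z + Ln (- ?ix) - Ein (- ?ix * z))" for z
  have T_deriv: "(T has_field_derivative eint n z / z ^ 2) (at z)" if z: "Im z > 0" for z
  proof -
    have z0: "z \<noteq> 0" using z by auto
    have w0: "- ?ix * z \<noteq> 0" using z0 x by simp
    have e: "exp (- (- ?ix * z)) = eint n z" by (simp add: eint_def x_def)
    have "(Ein has_field_derivative (1 - eint n z) / (- ?ix * z)) (at (- ?ix * z))"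
      using Ein_deriv[OF w0] by (simp only: e)
    then have "((\<lambda>z. Ein (- ?ix * z)) has_field_derivative (1 - eint n z) / (- ?ix * z) * (- ?ix * 1)) (at z)"
      by (rule DERIV_chain2) (intro DERIV_cmult DERIV_ident)
    moreover have "(1 - eint n z) / (- ?ix * z) * (- ?ix * 1) = (1 - eint n z) / z"
      using x z0 by (simp add: field_simps)
    ultimately have "((\<lambda>z. Ein (- ?ix * z)) has_field_derivative (1 - eint n z) / z) (at z)" by simp
    moreover have "((\<lambda>z. - eint n z / z) has_field_derivative
        (- (?ix * eint n z) * z - - eint n z * 1) / (z * z)) (at z)"
      using eint_deriv[of n z, folded x_def] z0 by (intro DERIV_divide DERIV_minus DERIV_ident)
    ultimately have "(T has_field_derivative (- (?ix * eint n z) * z - - eint n z * 1) / (z * z) +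
        ?ix * (inverse z + 0 - (1 - eint n z) / z)) (at z)"
      unfolding T_def using z
      by (intro DERIV_add DERIV_cmult DERIV_diff DERIV_const has_field_derivative_Ln nonpos_Reals_uhp)
    also have "(- (?ix * eint n z) * z - - eint n z * 1) / (z * z) +
        ?ix * (inverse z + 0 - (1 - eint n z) / z) = eint n z / z ^ 2"
      using z0 by (simp add: field_simps power2_eq_square)
    finally show ?thesis .
  qed
  have T_expint1: "T z = - eint n z / z + ?ix * (K - expint1 (- ?ix * z))" if z: "Im z > 0" "Re z \<ge> 0" for z
  proof -
    have z0: "z \<noteq> 0" using z by auto
    have "Ln (- ?ix * z) = Ln (- ?ix) + Ln z"
    proof (rule Ln_times_simple)
      have argz: "0 < Im (Ln z)" "Im (Ln z) \<le> pi / 2"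
        using Im_Ln_pos_lt_imp[of z] Re_Ln_pos_le[of z] z z0 by auto
      have "Im (Ln (- ?ix)) = (if x > 0 then - (pi / 2) else pi / 2)"
      proof -
        have "Ln (- ?ix) = of_real (ln x) + Ln (- \<i>)" if "x > 0"
          using Ln_times_of_real[OF that, of "- \<i>"] that by (simp add: mult.commute Ln_of_real)
        moreover have "Ln (- ?ix) = of_real (ln (- x)) + Ln \<i>" if "x < 0"
          using Ln_times_of_real[of "- x" "\<i>"] Ln_of_real[of "- x"] that by (simp add: mult.commute)
        ultimately show ?thesis using x by (cases "x > 0") auto
      qed
      then show "- pi < Im (Ln (- ?ix)) + Im (Ln z)" "Im (Ln (- ?ix)) + Im (Ln z) \<le> pi"
        using argz by (auto split: if_splits)
    qed (use x z0 in auto)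
    then show ?thesis by (simp add: T_def expint1_def K_def algebra_simps)
  qed
  have seg: "contour_integral unit_seg (\<lambda>z. eint n z / (z + of_nat j) ^ 2) =
      T (\<i> + of_nat (Suc j)) - T (\<i> + of_nat j)" for j
  proof -
    have "((\<lambda>z. T (z + of_nat j)) has_field_derivative eint n z / (z + of_nat j) ^ 2) (at z)"
      if z: "Im z > 0" for z
    proof -
      have "(T has_field_derivative eint n (z + of_nat j) / (z + of_nat j) ^ 2) (at (z + of_nat j))"
        by (rule T_deriv) (use z in simp)
      then show ?thesis by (simp only: DERIV_shift eint_add_nat)
    qed
    from unit_seg_primitive[OF this] show ?thesis by (simp add: add_ac)
  qed
  have "(\<Sum>j<N. contour_integral unit_seg (\<lambda>z. eint n z / (z + of_nat j) ^ 2)) = T (\<i> + of_nat N) - T \<i>" for N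
    unfolding seg using sum_lessThan_telescope[of "\<lambda>j. T (\<i> + of_nat j)" N] by simp
  with zeta_fourier_2_sums[of n] have "(\<lambda>N. T (\<i> + of_nat N) - T \<i>) \<longlonglongrightarrow> zeta_fourier n 2"
    by (simp add: sums_def)
  moreover have "(\<lambda>N. T (\<i> + of_nat N)) \<longlonglongrightarrow> - 0 + ?ix * (K - 0)"
  proof -
    have "(\<lambda>N. eint n (\<i> + of_nat N) / (\<i> + of_nat N)) \<longlonglongrightarrow> 0"
    proof (rule Lim_null_comparison)
      show "(\<lambda>N. exp (- x) / real N) \<longlonglongrightarrow> 0" by real_asymp
      show "\<forall>\<^sub>F N in sequentially. norm (eint n (\<i> + of_nat N) / (\<i> + of_nat N)) \<le> exp (- x) / real N"
        using eventually_gt_at_top[of 0]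
      proof eventually_elim
        case (elim N)
        have "real N \<le> norm (\<i> + of_nat N)" using abs_Re_le_cmod[of "\<i> + of_nat N"] by simp
        then show ?case
          using elim by (auto simp: norm_divide norm_eint x_def intro!: frac_le)
      qed
    qed
    moreover have "(\<lambda>N. expint1 (- ?ix * (\<i> + of_nat N))) \<longlonglongrightarrow> 0"
    proof (rule Lim_null_comparison)
      show "(\<lambda>N. (1 + exp (\<bar>x\<bar> + 1) * \<bar>x - 1\<bar>) / \<bar>- x * real N\<bar>) \<longlonglongrightarrow> 0"
      proof -
        have "(\<lambda>N. (1 + exp (\<bar>x\<bar> + 1) * \<bar>x - 1\<bar>) / \<bar>x\<bar> * (1 / real N)) \<longlonglongrightarrow> (1 + exp (\<bar>x\<bar> + 1) * \<bar>x - 1\<bar>) / \<bar>x\<bar> * 0"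
          by (intro tendsto_mult tendsto_const lim_1_over_n)
        then show ?thesis by (simp add: abs_mult)
      qed
      show "\<forall>\<^sub>F N in sequentially. norm (expint1 (- ?ix * (\<i> + of_nat N))) \<le>
          (1 + exp (\<bar>x\<bar> + 1) * \<bar>x - 1\<bar>) / \<bar>- x * real N\<bar>"
        using eventually_gt_at_top[of 0]
      proof eventually_elim
        case (elim N)
        have "- ?ix * (\<i> + of_nat N) = Complex x (- x * real N)"
          by (simp add: complex_eq_iff)
        then show ?case using expint1_bound[of "- x * real N" x] elim x by simp
      qed
    qed
    ultimately have "(\<lambda>N. - (eint n (\<i> + of_nat N) / (\<i> + of_nat N)) + ?ix * (K - expint1 (- ?ix * (\<i> + of_nat N))))
        \<longlonglongrightarrow> - 0 + ?ix * (K - 0)"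
      by (intro tendsto_intros)
    then show ?thesis by (simp add: T_expint1)
  qed
  ultimately have "zeta_fourier n 2 = ?ix * K - T \<i>"
    by (intro LIMSEQ_unique[of "\<lambda>N. T (\<i> + of_nat N) - T \<i>"] tendsto_intros) (auto intro!: tendsto_eq_intros)
  also have "T \<i> = \<i> * exp (- of_real x) + ?ix * (K - expint1 (of_real x))"
  proof -
    have eq: "- ?ix * \<i> = of_real x" by (simp add: complex_eq_iff)
    show ?thesis
      using T_expint1[of \<i>, unfolded eq] by (simp add: eint_i x_def)
  qed
  finally show ?thesis by (simp add: algebra_simps)
qed

text \<open>
  The recurrence at \<open>a = 1\<close>, solved for the value at \<open>1\<close>.
\<close>

lemma zeta_fourier_1:
  fixes n :: int
  assumes n: "n \<noteq> 0"
  shows "zeta_fourier n 1 = expint1 (of_real (2 * pi * of_int n))"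
proof -
  let ?x = "complex_of_real (2 * pi * of_int n)"
  have x: "?x \<noteq> 0" using n by simp
  have "\<i> * ?x * zeta_fourier n 1 = zeta_fourier n 2 - exp (- ?x) * \<i> powr (- 1)"
    using zeta_fourier_rec[OF n, of 1] by simp
  also have "\<i> powr (- 1) = - \<i>" by (simp add: powr_minus)
  also have "zeta_fourier n 2 - exp (- ?x) * - \<i> = \<i> * ?x * expint1 ?x"
    using zeta_fourier_2[OF n] by simp
  finally show ?thesis using x by simp
qed

text \<open>
  Multiplication by \<open>\<i> powr (s - 1)\<close> turns the recurrence of the Fourier coefficients into that of
  the exponential integrals. Going up from \<open>i\<close> to \<open>i + 1\<close> divides by \<open>i\<close>, which is harmless from
  \<open>i = 1\<close> on; going down divides by \<open>x\<close>.
\<close>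

lemma zeta_fourier_eq_exp_integral:
  fixes n s :: int
  assumes n: "n \<noteq> 0"
  shows "\<i> powr (of_int s - 1) * zeta_fourier n (of_int s) =
    exp_integral_E (of_int s) (of_real (2 * pi * of_int n))"
proof -
  define x where "x = 2 * pi * real_of_int n"
  have x: "x \<noteq> 0" using n by (simp add: x_def)
  define V where "V s = \<i> powr (of_int s - 1) * zeta_fourier n (of_int s)" for s :: int
  define W where "W s = exp_integral_E (of_int s) (of_real x)" for s :: int
  have V_rec: "of_real x * V s = exp (- of_real x) - of_int s * V (s + 1)" for s
  proof -
    have i1: "\<i> powr (of_int s - 1) = \<i> powr of_int s / \<i>"
      by (simp add: powr_diff)
    have i2: "\<i> powr of_int s * \<i> powr (- of_int s) = 1"
      by (simp add: powr_minus)
    have "\<i> * of_real x * zeta_fourier n (of_int s) = of_int s * zeta_fourier n (of_int s + 1)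
        - exp (- of_real x) * \<i> powr (- of_int s)"
      using zeta_fourier_rec[OF n, of "of_int s"] by (simp only: x_def)
    then have "\<i> powr of_int s * (\<i> * of_real x * zeta_fourier n (of_int s)) =
        of_int s * (\<i> powr of_int s * zeta_fourier n (of_int s + 1))
        - exp (- of_real x) * (\<i> powr of_int s * \<i> powr (- of_int s))"
      by (simp only: right_diff_distrib mult_ac)
    then have *: "\<i> powr of_int s * (\<i> * of_real x * zeta_fourier n (of_int s)) =
        of_int s * V (s + 1) - exp (- of_real x)"
      by (simp only: i2 mult_1_right) (simp add: V_def)
    have "of_real x * V s = - (\<i> powr of_int s * (\<i> * of_real x * zeta_fourier n (of_int s)))"
      by (simp add: V_def i1 divide_simps mult_ac)
    with * show ?thesis by simp
  qed
  have W_rec: "of_real x * W s = exp (- of_real x) - of_int s * W (s + 1)" for s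
    using exp_integral_E_rec[OF x, of s] by (simp add: W_def)
  have "V s = W s"
  proof (induction s rule: int_induct[where k = 1])
    case base
    show ?case
      using zeta_fourier_1[OF n] exp_integral_E_1[OF x] by (simp add: V_def W_def x_def)
  next
    case (step1 i)
    then have "of_int i * V (i + 1) = of_int i * W (i + 1)"
      using V_rec[of i] W_rec[of i] by (metis (no_types, lifting) diff_left_imp_eq)
    then show ?case using step1 by simp
  next
    case (step2 i)
    then have "of_real x * V (i - 1) = of_real x * W (i - 1)"
      using V_rec[of "i - 1"] W_rec[of "i - 1"] by simp
    then show ?case using x by simp
  qed
  then show ?thesis by (simp only: V_def W_def x_def)
qed

section \<open>Termwise integration of Fourier expansions\<close>

lemma has_fourier_expansion_1_iff:
  "has_fourier_expansion f 1 a \<longleftrightarrow> (\<exists>n0 :: nat. \<forall>n < - int n0. a n = 0) \<and>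
     (\<forall>z. Im z > 0 \<longrightarrow> ((\<lambda>n. a n * eint n z) has_sum f z) UNIV)"
proof -
  have "exp (2 * of_real pi * \<i> * of_int n * z / of_nat 1) = eint n z" for n z
    by (simp add: eint_def mult_ac)
  then show ?thesis by (simp only: has_fourier_expansion_def)
qed

text \<open>
  The Weierstrass test applies with the absolute values of the terms at \<open>\<i>\<close>, since
  \<open>\<bar>exp (2 \<pi> i n z)\<bar>\<close> depends only on \<open>Im z\<close>.
\<close>

lemma fourier_expansion_integral:
  assumes f: "has_fourier_expansion f 1 a" and h: "continuous_on uhp h"
  shows "((\<lambda>n. a n * contour_integral unit_seg (\<lambda>z. eint n z * h z)) has_sum
    contour_integral unit_seg (\<lambda>z. f z * h z)) UNIV"
proof -
  let ?S = "closed_segment \<i> (\<i> + 1)"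
  have sums: "((\<lambda>n. a n * eint n z) has_sum f z) UNIV" if "Im z > 0" for z
    using f that unfolding has_fourier_expansion_1_iff by blast
  have conth: "continuous_on ?S h"
    by (rule continuous_on_subset[OF h unit_seg_subset_uhp])
  obtain B where B: "\<And>z. z \<in> ?S \<Longrightarrow> norm (h z) \<le> B"
    using compact_imp_bounded[OF compact_continuous_image[OF conth compact_segment]]
    by (auto simp: bounded_iff)
  have int: "(\<lambda>z. a n * eint n z * h z) contour_integrable_on unit_seg" for n
    by (intro unit_seg_integrable continuous_intros continuous_on_eint h)
  have ul: "uniform_limit (path_image unit_seg) (\<lambda>N z. \<Sum>n\<in>N. a n * eint n z * h z)
      (\<lambda>z. f z * h z) (finite_subsets_at_top UNIV)"
  proof (rule Weierstrass_m_test_general')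
    show "norm (a n * eint n z * h z) \<le> norm (a n * eint n \<i>) * B" if "z \<in> path_image unit_seg" for n z
    proof -
      from that have z: "z \<in> ?S" by simp
      then have "Im z = 1" by (simp add: unit_seg_mem)
      then have "norm (a n * eint n z) = norm (a n * eint n \<i>)" by (simp add: norm_mult norm_eint)
      then show ?thesis
        unfolding norm_mult[of _ "h z"] using B[OF z] by (simp only: mult_left_mono norm_ge_zero)
    qed
    have "(\<lambda>n. a n * eint n \<i>) summable_on UNIV"
      using sums[of \<i>] by (auto simp: summable_on_def)
    then show "(\<lambda>n. norm (a n * eint n \<i>) * B) summable_on UNIV"
      by (intro summable_on_cmult_left) (simp add: summable_on_iff_abs_summable_on_complex)
    show "((\<lambda>n. a n * eint n z * h z) has_sum f z * h z) UNIV" if "z \<in> path_image unit_seg" for z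
      by (rule has_sum_cmult_left[OF sums]) (use that in \<open>simp add: unit_seg_mem\<close>)
  qed
  have "((\<lambda>N. contour_integral unit_seg (\<lambda>z. \<Sum>n\<in>N. a n * eint n z * h z)) \<longlongrightarrow>
      contour_integral unit_seg (\<lambda>z. f z * h z)) (finite_subsets_at_top UNIV)"
  proof (rule contour_integral_uniform_limit(2)[OF _ ul, where B = 1])
    show "\<forall>\<^sub>F N in finite_subsets_at_top UNIV. (\<lambda>z. \<Sum>n\<in>N. a n * eint n z * h z) contour_integrable_on unit_seg"
      using eventually_finite_subsets_at_top_weakI[of UNIV finite]
      by (rule eventually_mono) (auto intro!: contour_integrable_sum int)
  qed auto
  moreover have "\<forall>\<^sub>F N in finite_subsets_at_top UNIV.
      contour_integral unit_seg (\<lambda>z. \<Sum>n\<in>N. a n * eint n z * h z) =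
      (\<Sum>n\<in>N. a n * contour_integral unit_seg (\<lambda>z. eint n z * h z))"
  proof (rule eventually_finite_subsets_at_top_weakI)
    fix N :: "int set" assume "finite N"
    then have "contour_integral unit_seg (\<lambda>z. \<Sum>n\<in>N. a n * eint n z * h z) =
        (\<Sum>n\<in>N. contour_integral unit_seg (\<lambda>z. a n * eint n z * h z))"
      by (rule contour_integral_sum) (rule int)
    also have "\<dots> = (\<Sum>n\<in>N. a n * contour_integral unit_seg (\<lambda>z. eint n z * h z))"
      unfolding mult.assoc
      by (intro sum.cong refl contour_integral_lmul unit_seg_integrable continuous_intros
          continuous_on_eint h)
    finally show "contour_integral unit_seg (\<lambda>z. \<Sum>n\<in>N. a n * eint n z * h z) =
      (\<Sum>n\<in>N. a n * contour_integral unit_seg (\<lambda>z. eint n z * h z))" .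
  qed
  ultimately show ?thesis
    unfolding has_sum_def by (simp add: tendsto_cong)
qed

text \<open>
  Termwise integration against \<open>exp (- 2 \<pi> i m z)\<close>; this makes the coefficients unique.
\<close>

lemma fourier_coeff_integral:
  assumes f: "has_fourier_expansion f 1 a"
  shows "a m = contour_integral unit_seg (\<lambda>z. f z * eint (- m) z)"
proof -
  have e: "eint n z * eint (- m) z = eint (n - m) z" for n z
    by (simp add: eint_def exp_add[symmetric] algebra_simps)
  have "((\<lambda>n. a n * contour_integral unit_seg (eint (n - m))) has_sum
      contour_integral unit_seg (\<lambda>z. f z * eint (- m) z)) UNIV"
    using fourier_expansion_integral[OF f continuous_on_eint, of "- m"] by (simp only: e)
  then have "((\<lambda>n. a n * contour_integral unit_seg (eint (n - m))) has_sum
      contour_integral unit_seg (\<lambda>z. f z * eint (- m) z)) {m}"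
    by (rule has_sum_cong_neutral[THEN iffD1, rotated -1]) (auto simp: unit_seg_integral_eint)
  from has_sum_unique[OF this has_sum_finite] show ?thesis
    by (simp add: unit_seg_integral_eint)
qed

lemma fourier_coeff_eq:
  assumes "has_fourier_expansion f 1 a"
  shows "fourier_coeff f 1 = a"
  unfolding fourier_coeff_def
proof (rule the_equality)
  fix b assume "has_fourier_expansion f 1 b"
  then show "b = a"
    using fourier_coeff_integral[OF assms] fourier_coeff_integral by (auto simp: fun_eq_iff)
qed (rule assms)

lemma mat_1_SL2Z: "mat 1 \<in> SL2Z"
  by (simp add: SL2Z_def)

lemma slash_mat_1: "slash k (mat 1) f = f"
  by (simp add: slash_def mat_def fun_eq_iff)

lemma cusp_width_mat_1: "cusp_width N (mat 1) = 1"
proof -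
  have inv: "matrix_inv (mat 1 :: int ^ 2 ^ 2) = mat 1"
  proof -
    have "(mat 1 :: int ^ 2 ^ 2) ** matrix_inv (mat 1) = mat 1 \<and> matrix_inv (mat 1) ** (mat 1 :: int ^ 2 ^ 2) = mat 1"
      unfolding matrix_inv_def by (rule someI[of _ "mat 1"]) simp
    then show ?thesis by simp
  qed
  have "transl 1 \<in> Gamma0 N"
    by (simp add: Gamma0_def SL2Z_def transl_def det_2)
  then show ?thesis
    unfolding cusp_width_def by (intro Least_equality) (auto simp: inv)
qed

theorem theorem1p2:
  fixes k m :: int and N :: nat and f :: "complex \<Rightarrow> complex"
  assumes "N > 0"
    and "f \<in> weakly_holomorphic_cusp_forms k N"
  shows "L_star f (of_int m) =
    \<i> powi (- m) *
    contour_integral (linepath \<i> (\<i> + 1)) (\<lambda>z. f z * zeta_star (1 - of_int m) z)"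
proof -
  obtain a where a: "has_fourier_expansion f 1 a"
  proof -
    have "\<exists>a. has_fourier_expansion (slash k (mat 1) f) (cusp_width N (mat 1)) a"
      using assms(2) mat_1_SL2Z
      by (auto simp: weakly_holomorphic_cusp_forms_def weakly_holomorphic_forms_def)
    then show ?thesis using that by (auto simp: slash_mat_1 cusp_width_mat_1)
  qed
  have "fourier_coeff (slash k (mat 1) f) (cusp_width N (mat 1)) 0 = 0"
    using assms(2) mat_1_SL2Z by (auto simp: weakly_holomorphic_cusp_forms_def)
  then have a0: "a 0 = 0"
    by (simp only: slash_mat_1 cusp_width_mat_1 fourier_coeff_eq[OF a])
  let ?I = "contour_integral unit_seg (\<lambda>z. f z * zeta_star (1 - of_int m) z)"
  have "((\<lambda>n. a n * zeta_fourier n (1 - of_int m)) has_sum ?I) UNIV"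
    using fourier_expansion_integral[OF a continuous_on_zeta_star] by (simp only: zeta_fourier_def)
  then have "((\<lambda>n. a n * zeta_fourier n (1 - of_int m)) has_sum ?I) {n. n \<noteq> 0}"
    by (rule has_sum_cong_neutral[THEN iffD1, rotated -1]) (auto simp: a0)
  then have "((\<lambda>n. \<i> powi (- m) * (a n * zeta_fourier n (1 - of_int m))) has_sum \<i> powi (- m) * ?I) {n. n \<noteq> 0}"
    by (rule has_sum_cmult_right)
  moreover have "\<i> powi (- m) * (a n * zeta_fourier n (1 - of_int m)) =
      fourier_coeff f 1 n * exp_integral_E (1 - of_int m) (2 * of_real pi * of_int n)"
    if "n \<in> {n. n \<noteq> 0}" for n
  proof -
    have "\<i> powi (- m) = \<i> powr (of_int (1 - m) - 1)"
      using complex_powr_of_int[of "\<i>" "- m"] by simp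
    then show ?thesis
      using zeta_fourier_eq_exp_integral[of n "1 - m"] fourier_coeff_eq[OF a] that
      by (simp add: mult.left_commute)
  qed
  ultimately have "((\<lambda>n. fourier_coeff f 1 n * exp_integral_E (1 - of_int m) (2 * of_real pi * of_int n))
      has_sum \<i> powi (- m) * ?I) {n. n \<noteq> 0}"
    by (rule has_sum_cong[THEN iffD1, rotated])
  then show ?thesis
    unfolding L_star_def by (rule infsumI)
qed

end
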